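(* Let $f_Q(x)=x^TMx+d^Tx$, where $M\in\mathbb{R}^{n\times n}$ is a symmetric, possibly indefinite, matrix with real eigenvalues $s_1,\dots,s_n$. Consider the first update (Update-1) of the scheme ADMM$_{\rm cf}^{\mu,\alpha,\rho}$ at iteration $k+1$, $$w_{k+1}:=\mathrm{argmin}_{w\in Z_1}\ \tilde{\mathcal{L}}_{\rho,\alpha}(w,y_k,\lambda_k)+\frac{\mu}{2}\|w-w_k\|^2 .$$ Then $(\rho+\mu)I+4M\succ0$ implies $\rho+\mu+4s_i>0$ for all $i=1,\dots,n$, and the following hold: (i) The solution $w_{k+1}=(x^+_{k+1};x^-_{k+1};\xi_{k+1})$ can be obtained as a solution to a tractable convex program. (ii) The solution $w_{k+1}$ is available in closed form. In particular, let $h=(d;-d;-\gamma e)+(1-\rho\alpha)\lambda_k-\rho y_k-\mu w_k$, let $V$ be an orthogonal matrix such that $V^TMV=\mathrm{diag}(s_1,\dots,s_n)$, and let $$G=\begin{pmatrix}\frac12I_n&\frac{\sqrt2}{2}I_n&\frac12I_n\\ \frac12I_n&-\frac{\sqrt2}{2}I_n&\frac12I_n\\-\frac{\sqrt2}{2}I_n&0&\frac{\sqrt2}{2}I_n\end{pmatrix}\begin{pmatrix}I_n&0&0\\0&V&0\\0&0&I_n\end{pmatrix}.$$ Also let $q=G^Th=(q_1;q_2;q_3)$ and $z=(z_1;z_2;z_3)$ with $q_1,q_2,q_3,z_1,z_2,z_3\in\mathbb{R}^n$ and $$z_1=\begin{cases}\dfrac{-(\|q_1\|+\|q_3\|)q_1}{2(\rho+\mu)\|q_1\|},&\|q_1\|>0,\\[2mm]\dfrac{\|q_3\|}{2(\rho+\mu)}u,\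 \|u\|=1,&\|q_1\|=0,\end{cases}\qquad z_3=\begin{cases}\dfrac{-(\|q_1\|+\|q_3\|)q_3}{2(\rho+\mu)\|q_3\|},&\|q_3\|>0,\\[2mm]\dfrac{\|q_1\|}{2(\rho+\mu)}v,\ \|v\|=1,&\|q_3\|=0,\end{cases}$$ $$(z_2)_i=-\frac{(q_2)_i}{\rho+\mu+4s_i},\quad i=1,\dots,n.$$ Then $w_{k+1}=Gz$ is the solution to (Update-1).
   Context: Let $d\in\mathbb{R}^n$, $\gamma>0$, and let $g:\mathbb{R}^n\to\mathbb{R}$ be a smooth convex function. Write $w=(x^+;x^-;\xi)$ and $y=(y^+;y^-;\zeta)$ with all blocks in $\mathbb{R}^n$; $e$ is the all-ones vector, $I_n$ the $n\times n$ identity matrix, and $\|\cdot\|$ the Euclidean norm. Define $$Z_1=\{(x^+;x^-;\xi)\in\mathbb{R}^{3n}:(x^++x^-)^T\xi=0\},$$ $$\tilde{\mathcal{L}}_{\rho,\alpha}(w,y,\lambda)=f_Q(x^+-x^-)+\gamma\sum_{i=1}^n(1-\xi_i)+g(y^+-y^-)+(1-\rho\alpha)\lambda^T(w-y-\alpha\lambda)+\frac\rho2\|w-y\|^2.$$ The parameters of the scheme ADMM$_{\rm cf}^{\mu,\alpha,\rho}$ (a perturbed proximal alternating direction method of multipliers) are $\alpha,\rho,\mu>0$ with $\rho\alpha\in(0,1)$ and $(\rho+\mu)I+4M\succ0$; $w_k,y_k,\lambda_k\in\mathbb{R}^{3n}$ are the current iterates. "Tractable" means that the problem either has a closed-form solution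 or lies in the range of convex programs that are polynomially solvable. *)

theory Defs
  imports "HOL-Analysis.Analysis"
begin

text \<open>
  A vector (or, when the entries are themselves rows, a block matrix) indexed by \<open>'n + 'n + 'n\<close>
  consists of three stacked blocks indexed by \<open>'n\<close>; the Euclidean space of dimension
  \<open>3 * CARD('n)\<close> is \<open>real^('n + 'n + 'n)\<close>.
\<close>

type_synonym 'n vec3 = "real^('n + 'n + 'n)"
type_synonym 'n mat3 = "real^('n + 'n + 'n)^('n + 'n + 'n)"

definition stack3 :: "'a^'n \<Rightarrow> 'a^'n \<Rightarrow> 'a^'n \<Rightarrow> 'a^('n::finite + 'n + 'n)" where
  "stack3 a b c = (\<chi> k. case k of Inl i \<Rightarrow> a $ i | Inr (Inl i) \<Rightarrow> b $ i | Inr (Inr i) \<Rightarrow> c $ i)"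

definition blk1 :: "'a^('n::finite + 'n + 'n) \<Rightarrow> 'a^'n" where
  "blk1 w = (\<chi> i. w $ Inl i)"

definition blk2 :: "'a^('n::finite + 'n + 'n) \<Rightarrow> 'a^'n" where
  "blk2 w = (\<chi> i. w $ Inr (Inl i))"

definition blk3 :: "'a^('n::finite + 'n + 'n) \<Rightarrow> 'a^'n" where
  "blk3 w = (\<chi> i. w $ Inr (Inr i))"

definition block_row :: "real^'n^'n \<Rightarrow> real^'n^'n \<Rightarrow> real^'n^'n \<Rightarrow> real^('n::finite + 'n + 'n)^'n" where
  "block_row A B C = (\<chi> i. stack3 (A $ i) (B $ i) (C $ i))"

definition diag_mat :: "real^'n \<Rightarrow> real^'n^'n" where
  "diag_mat s = (\<chi> i j. if i = j then s $ i else 0)"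

definition pos_def :: "real^'n^'n \<Rightarrow> bool" where
  "pos_def A \<longleftrightarrow> transpose A = A \<and> (\<forall>x. x \<noteq> 0 \<longrightarrow> x \<bullet> (A *v x) > 0)"

text \<open>The entries of \<open>s\<close> are the eigenvalues of \<open>M\<close>, listed with multiplicity.\<close>

definition eigenvalue_list :: "real^'n^'n \<Rightarrow> real^'n \<Rightarrow> bool" where
  "eigenvalue_list M s \<longleftrightarrow> (\<forall>x. det (mat x - M) = (\<Prod>i\<in>UNIV. x - s $ i))"

definition cont_differentiable :: "(real^'n \<Rightarrow> real) \<Rightarrow> bool" where
  "cont_differentiable g \<longleftrightarrow>
     (\<exists>g'. (\<forall>x. (g has_derivative (\<lambda>v. g' x \<bullet> v)) (at x)) \<and> continuous_on UNIV g')"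

definition f_Q :: "real^'n^'n \<Rightarrow> real^'n \<Rightarrow> real^'n \<Rightarrow> real" where
  "f_Q M d x = x \<bullet> (M *v x) + d \<bullet> x"

definition Z1 :: "'n::finite vec3 set" where
  "Z1 = {w. (blk1 w + blk2 w) \<bullet> blk3 w = 0}"

definition L_tilde ::
  "real^'n^'n \<Rightarrow> real^'n \<Rightarrow> real \<Rightarrow> (real^'n \<Rightarrow> real) \<Rightarrow> real \<Rightarrow> real
     \<Rightarrow> 'n::finite vec3 \<Rightarrow> 'n vec3 \<Rightarrow> 'n vec3 \<Rightarrow> real" where
  "L_tilde M d \<gamma> g \<rho> \<alpha> w y lam =
     f_Q M d (blk1 w - blk2 w) + \<gamma> * (\<Sum>i\<in>UNIV. 1 - blk3 w $ i) + g (blk1 y - blk2 y)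
     + (1 - \<rho> * \<alpha>) * (lam \<bullet> (w - y - \<alpha> *\<^sub>R lam)) + \<rho> / 2 * (norm (w - y))\<^sup>2"

definition update1_solution ::
  "real^'n^'n \<Rightarrow> real^'n \<Rightarrow> real \<Rightarrow> (real^'n \<Rightarrow> real) \<Rightarrow> real \<Rightarrow> real \<Rightarrow> real
     \<Rightarrow> 'n::finite vec3 \<Rightarrow> 'n vec3 \<Rightarrow> 'n vec3 \<Rightarrow> 'n vec3 \<Rightarrow> bool" where
  "update1_solution M d \<gamma> g \<rho> \<alpha> \<mu> wk yk lamk w \<longleftrightarrow>
     is_arg_min (\<lambda>w. L_tilde M d \<gamma> g \<rho> \<alpha> w yk lamk + \<mu> / 2 * (norm (w - wk))\<^sup>2)
       (\<lambda>w. w \<in> Z1) w"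

definition h_vec ::
  "real^'n \<Rightarrow> real \<Rightarrow> real \<Rightarrow> real \<Rightarrow> real \<Rightarrow> 'n::finite vec3 \<Rightarrow> 'n vec3 \<Rightarrow> 'n vec3 \<Rightarrow> 'n vec3" where
  "h_vec d \<gamma> \<rho> \<alpha> \<mu> wk yk lamk =
     stack3 d (- d) (- (\<gamma> *\<^sub>R 1)) + (1 - \<rho> * \<alpha>) *\<^sub>R lamk - \<rho> *\<^sub>R yk - \<mu> *\<^sub>R wk"

definition G_mat :: "real^'n^'n \<Rightarrow> 'n::finite mat3" where
  "G_mat V =
     stack3
       (block_row (mat (1/2)) (mat (sqrt 2 / 2)) (mat (1/2)))
       (block_row (mat (1/2)) (mat (- (sqrt 2 / 2))) (mat (1/2)))
       (block_row (mat (- (sqrt 2 / 2))) (mat 0) (mat (sqrt 2 / 2)))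
     ** stack3
       (block_row (mat 1) (mat 0) (mat 0))
       (block_row (mat 0) V (mat 0))
       (block_row (mat 0) (mat 0) (mat 1))"

text \<open>
  The admissible values of the first block of \<open>z\<close> (with \<open>q = q\<^sub>1\<close>, \<open>q' = q\<^sub>3\<close>) and of its
  third block (with the roles of \<open>q\<^sub>1\<close> and \<open>q\<^sub>3\<close> exchanged); \<open>\<beta>\<close> stands for \<open>\<rho> + \<mu>\<close>.
  The unit vector occurring for \<open>q = 0\<close> is arbitrary, so this is a relation.
\<close>

definition outer_block :: "real \<Rightarrow> real^'n \<Rightarrow> real^'n \<Rightarrow> real^'n \<Rightarrow> bool" where
  "outer_block \<beta> q q' x \<longleftrightarrow>
     (if norm q > 0 then x = (- (norm q + norm q') / (2 * \<beta> * norm q)) *\<^sub>R q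
      else \<exists>u. norm u = 1 \<and> x = (norm q' / (2 * \<beta>)) *\<^sub>R u)"

definition z_formula :: "real \<Rightarrow> real^'n \<Rightarrow> 'n::finite vec3 \<Rightarrow> 'n vec3 \<Rightarrow> bool" where
  "z_formula \<beta> s q z \<longleftrightarrow>
     outer_block \<beta> (blk1 q) (blk3 q) (blk1 z) \<and>
     outer_block \<beta> (blk3 q) (blk1 q) (blk3 z) \<and>
     (\<forall>i. blk2 z $ i = - (blk2 q $ i) / (\<beta> + 4 * s $ i))"

text \<open>
  The convex program. With \<open>z\<^sub>1\<close>, \<open>z\<^sub>3\<close> the first and last block of \<open>G\<^sup>T w\<close> (they do not depend
  on \<open>V\<close>), membership of \<open>w\<close> in \<open>Z1\<close> says that \<open>z\<^sub>1\<close> and \<open>z\<^sub>3\<close> have equal norms, and the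
  objective of the update is, up to a constant and with \<open>x\<close> denoting the difference of the first
  two blocks of \<open>w\<close>, the sum of \<open>h\<^sup>T w\<close>, of \<open>x\<^sup>T M x + \<beta>/4 |x|\<^sup>2\<close>, and of \<open>\<beta>/2\<close> times
  \<open>|z\<^sub>1|\<^sup>2 + |z\<^sub>3|\<^sup>2\<close>. Relaxing the common value \<open>|z\<^sub>1|\<^sup>2 = |z\<^sub>3|\<^sup>2\<close> to an upper bound \<open>t\<close> gives a
  quadratic program in \<open>(w, t)\<close> with two convex quadratic constraints.
\<close>

definition cp_feasible :: "('n::finite vec3 \<times> real) set" where
  "cp_feasible =
     {(w, t). (norm ((1/2) *\<^sub>R (blk1 w + blk2 w) - (sqrt 2 / 2) *\<^sub>R blk3 w))\<^sup>2 \<le> t \<and>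
              (norm ((1/2) *\<^sub>R (blk1 w + blk2 w) + (sqrt 2 / 2) *\<^sub>R blk3 w))\<^sup>2 \<le> t}"

definition cp_objective :: "real^'n^'n \<Rightarrow> 'n::finite vec3 \<Rightarrow> real \<Rightarrow> 'n vec3 \<times> real \<Rightarrow> real" where
  "cp_objective M h \<beta> p =
     (case p of (w, t) \<Rightarrow>
        (blk1 w - blk2 w) \<bullet> (M *v (blk1 w - blk2 w)) + \<beta> / 4 * (norm (blk1 w - blk2 w))\<^sup>2
        + h \<bullet> w + \<beta> * t)"

definition cp_solution :: "real^'n^'n \<Rightarrow> 'n::finite vec3 \<Rightarrow> real \<Rightarrow> 'n vec3 \<times> real \<Rightarrow> bool" where
  "cp_solution M h \<beta> p \<longleftrightarrow> is_arg_min (cp_objective M h \<beta>) (\<lambda>p. p \<in> cp_feasible) p"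

definition convex_program :: "'v::real_vector set \<Rightarrow> ('v \<Rightarrow> real) \<Rightarrow> bool" where
  "convex_program F f \<longleftrightarrow> convex F \<and> convex_on F f"

text \<open>
  Straight-line computations in the real-number model: \<open>straight_line X m F\<close> says that, starting
  from the input quantities \<open>X\<close> (real functions of the problem data), \<open>m\<close> elementary steps
  (rational constants, arithmetic operations, square roots, case distinctions on a sign) produce
  the quantities \<open>F\<close>. Intermediate results may be reused.
\<close>

inductive straight_line :: "('d \<Rightarrow> real) set \<Rightarrow> nat \<Rightarrow> ('d \<Rightarrow> real) set \<Rightarrow> bool"
  for X :: "('d \<Rightarrow> real) set" where
  "straight_line X 0 X"
| "\<lbrakk>straight_line X m F; r \<in> \<rat>\<rbrakk> \<Longrightarrow> straight_line X (Suc m) (insert (\<lambda>_. r) F)"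
| "\<lbrakk>straight_line X m F; a \<in> F; b \<in> F\<rbrakk> \<Longrightarrow> straight_line X (Suc m) (insert (\<lambda>D. a D + b D) F)"
| "\<lbrakk>straight_line X m F; a \<in> F; b \<in> F\<rbrakk> \<Longrightarrow> straight_line X (Suc m) (insert (\<lambda>D. a D - b D) F)"
| "\<lbrakk>straight_line X m F; a \<in> F; b \<in> F\<rbrakk> \<Longrightarrow> straight_line X (Suc m) (insert (\<lambda>D. a D * b D) F)"
| "\<lbrakk>straight_line X m F; a \<in> F; b \<in> F\<rbrakk> \<Longrightarrow> straight_line X (Suc m) (insert (\<lambda>D. a D / b D) F)"
| "\<lbrakk>straight_line X m F; a \<in> F\<rbrakk> \<Longrightarrow> straight_line X (Suc m) (insert (\<lambda>D. sqrt (a D)) F)"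
| "\<lbrakk>straight_line X m F; a \<in> F; b \<in> F; c \<in> F\<rbrakk> \<Longrightarrow>
     straight_line X (Suc m) (insert (\<lambda>D. if a D \<le> 0 then b D else c D) F)"

text \<open>
  A parametric problem with instances \<open>A\<close> and acceptable answers \<open>S D\<close> is solved, exactly and for
  all instances at once, by a formula evaluated in at most \<open>N\<close> steps.
\<close>

definition solvable_in_steps ::
  "('d \<Rightarrow> real) set \<Rightarrow> 'd set \<Rightarrow> nat \<Rightarrow> ('d \<Rightarrow> 'v::euclidean_space set) \<Rightarrow> bool" where
  "solvable_in_steps X A N S \<longleftrightarrow>
     (\<exists>sol m F. straight_line X m F \<and> m \<le> N \<and>
        (\<forall>b\<in>Basis. (\<lambda>D. sol D \<bullet> b) \<in> F) \<and> (\<forall>D\<in>A. sol D \<in> S D))"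

text \<open>
  The numerical data of an instance of the update; the function \<open>g\<close> enters its objective only
  through an additive constant.
\<close>

record ('n::finite) update_data =
  dat_M :: "real^'n^'n"
  dat_d :: "real^'n"
  dat_gamma :: real
  dat_rho :: real
  dat_alpha :: real
  dat_mu :: real
  dat_w :: "real^('n + 'n + 'n)"
  dat_y :: "real^('n + 'n + 'n)"
  dat_lam :: "real^('n + 'n + 'n)"

definition admissible :: "real^'n^'n \<Rightarrow> real \<Rightarrow> real \<Rightarrow> real \<Rightarrow> real \<Rightarrow> bool" where
  "admissible M \<gamma> \<rho> \<alpha> \<mu> \<longleftrightarrow>
     transpose M = M \<and> \<gamma> > 0 \<and> \<alpha> > 0 \<and> \<rho> > 0 \<and> \<mu> > 0 \<and> \<rho> * \<alpha> < 1 \<and>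
     pos_def ((\<rho> + \<mu>) *\<^sub>R mat 1 + 4 *\<^sub>R M)"

definition instances :: "('n::finite) update_data set" where
  "instances = {D. admissible (dat_M D) (dat_gamma D) (dat_rho D) (dat_alpha D) (dat_mu D)}"

definition inputs :: "(('n::finite) update_data \<Rightarrow> real) set" where
  "inputs =
     {dat_gamma, dat_rho, dat_alpha, dat_mu}
     \<union> (\<Union>i j. {\<lambda>D. dat_M D $ i $ j}) \<union> (\<Union>i. {\<lambda>D. dat_d D $ i})
     \<union> (\<Union>k. {\<lambda>D. dat_w D $ k, \<lambda>D. dat_y D $ k, \<lambda>D. dat_lam D $ k})"

definition dat_h :: "('n::finite) update_data \<Rightarrow> 'n vec3" where
  "dat_h D =
     h_vec (dat_d D) (dat_gamma D) (dat_rho D) (dat_alpha D) (dat_mu D)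
       (dat_w D) (dat_y D) (dat_lam D)"

text \<open>
  Tractability of the convex program: a solution whose \<open>w\<close>-part lies in \<open>Z1\<close> is
  computed from the data in polynomially many steps. The bound is the same polynomial for all
  dimensions \<open>CARD('n)\<close>.
\<close>

definition cp_tractable :: "'n::finite itself \<Rightarrow> bool" where
  "cp_tractable _ \<longleftrightarrow>
     solvable_in_steps inputs (instances :: 'n update_data set) (1000 * CARD('n) ^ 3)
       (\<lambda>D. {(w, t). w \<in> Z1 \<and> cp_solution (dat_M D) (dat_h D) (dat_rho D + dat_mu D) (w, t)})"

end

theory Submission
  imports Defs
begin

text \<open>
  In the rotated coordinates \<open>z = (z\<^sub>1, z\<^sub>2, z\<^sub>3)\<close> given by the orthogonal part of \<open>G_mat\<close>, the nonconvex
  constraint \<open>w \<in> Z1\<close> reads \<open>|z\<^sub>1| = |z\<^sub>3|\<close> (\<open>Z1_iff\<close>), and the quadratic form of \<open>M\<close> involves only the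
  middle block. With \<open>\<beta> = \<rho> + \<mu>\<close>, \<open>A = \<beta> I + 4 M\<close> and \<open>q\<close> the rotated \<open>h\<close>, the update therefore splits.
  The middle block minimises a strictly convex quadratic, whose stationarity condition is
  \<open>A z\<^sub>2 = - q\<^sub>2\<close>. For a common norm \<open>\<tau>\<close> of the outer blocks the best directions are opposite to \<open>q\<^sub>1\<close> and
  \<open>q\<^sub>3\<close>, with value \<open>\<beta> \<tau>\<^sup>2 - (|q\<^sub>1| + |q\<^sub>3|) \<tau>\<close>, smallest at \<open>\<tau> = (|q\<^sub>1| + |q\<^sub>3|) / (2 \<beta>)\<close>. If \<open>q\<^sub>1\<close> or \<open>q\<^sub>3\<close>
  vanishes, the corresponding direction is arbitrary.

  The value \<open>\<tau>\<^sup>2\<close> may be replaced by an upper bound \<open>t\<close> of both squared norms: Cauchy-Schwarz gives the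
  same lower bound for this convex relaxation, so it has the same optimal value. Both statements are
  contained in a single identity for the excess over the optimal value
  (\<open>reduced_objective_decomposition\<close>). As a consequence the solutions of the update, and the solutions of
  the relaxation that lie in \<open>Z1\<close>, are described by the same predicate \<open>reduced_solution\<close>
  (\<open>update1_solution_iff\<close>, \<open>cp_solution_iff\<close>). If \<open>V\<close> diagonalises \<open>M\<close>, substituting \<open>V z\<^sub>2\<close> for \<open>z\<^sub>2\<close> in
  this predicate gives the formula with eigenvalues (\<open>closed_form_iff\<close>).

  Tractability uses the predicate itself: its middle block is the solution of a positive definite
  linear system, found by Gaussian elimination without pivoting (\<open>computes_linear_solution\<close>), and its
  outer blocks are explicit, so that a solution is evaluated from the data in cubically many steps
  (\<open>cp_tractable\<close>).
\<close>

section \<open>Straight-line computations\<close>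

lemma straight_line_superset: "straight_line X m F \<Longrightarrow> X \<subseteq> F"
  by (induction rule: straight_line.induct) auto

lemma straight_line_append:
  assumes "straight_line F k H" "straight_line X m F"
  shows "straight_line X (m + k) H"
  using assms(1)
proof (induction rule: straight_line.induct)
  case 1
  then show ?case using assms(2) by simp
qed (auto intro: straight_line.intros)

lemma straight_line_more_inputs:
  assumes "straight_line X k H" "X \<subseteq> X'"
  shows "straight_line X' k (X' \<union> H)"
  using assms(1)
proof (induction rule: straight_line.induct)
  case 1
  then show ?case using assms(2) straight_line.intros(1)[of X'] by (simp add: Un_absorb2)
qed (simp_all add: straight_line.intros)

text \<open>
  Budgets in \<open>straight_line\<close> count every step exactly, and its inductive rules only extend one given
  set of quantities. Passing to an upper bound on the steps and a subset of the available quantities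
  makes costs compose: a formula costs what its parts cost plus one per operation. Bounds such as
  \<open>0 + (0 + 0 + 1) + 1\<close> in later proofs spell out this sum along the syntax tree of the formula.
\<close>

definition computes :: "('d \<Rightarrow> real) set \<Rightarrow> nat \<Rightarrow> ('d \<Rightarrow> real) set \<Rightarrow> bool" where
  "computes X m Y \<longleftrightarrow> (\<exists>k F. straight_line X k F \<and> k \<le> m \<and> Y \<subseteq> F)"

lemma computes_given: "Y \<subseteq> X \<Longrightarrow> computes X 0 Y"
  unfolding computes_def using straight_line.intros(1) by blast

lemma computes_weaken: "computes X m Y \<Longrightarrow> m \<le> m' \<Longrightarrow> Y' \<subseteq> Y \<Longrightarrow> computes X m' Y'"
  unfolding computes_def by (meson order_trans)

lemma computes_then:
  assumes "computes X m Y" "computes (X \<union> Y) k Z"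
  shows "computes X (m + k) (X \<union> Y \<union> Z)"
proof -
  obtain m' F where F: "straight_line X m' F" "m' \<le> m" "Y \<subseteq> F"
    using assms(1) unfolding computes_def by blast
  obtain k' H where H: "straight_line (X \<union> Y) k' H" "k' \<le> k" "Z \<subseteq> H"
    using assms(2) unfolding computes_def by blast
  have sub: "X \<union> Y \<subseteq> F" using F straight_line_superset by blast
  then have "straight_line X (m' + k') (F \<union> H)"
    using straight_line_append[OF straight_line_more_inputs[OF H(1)]] F(1) by blast
  then show ?thesis using F H sub unfolding computes_def
    by (intro exI[of _ "m' + k'"] exI[of _ "F \<union> H"]) auto
qed

lemma computes_more_inputs: "computes X m Y \<Longrightarrow> X \<subseteq> X' \<Longrightarrow> computes X' m Y"
  unfolding computes_def using straight_line_more_inputs by blast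

text \<open>
  Stages run one after the other, the quantities \<open>Y\<close> of the first stage being the inputs of the
  second. Sharing happens only here: within a stage each occurrence of a subformula is paid for again.
\<close>

lemma computes_extend:
  assumes "computes X m Y" "computes Y k Z"
  shows "computes X (m + k) (Y \<union> Z)"
  using computes_then[OF assms(1) computes_more_inputs[OF assms(2)]] by (auto elim: computes_weaken)

lemma computes_Un:
  assumes "computes X m Y" "computes X k Z"
  shows "computes X (m + k) (Y \<union> Z)"
  using computes_then[OF assms(1) computes_more_inputs[OF assms(2), of "X \<union> Y"]]
  by (auto elim: computes_weaken)

lemma computes_family:
  assumes "finite I" "\<And>i. i \<in> I \<Longrightarrow> computes X m {f i}"
  shows "computes X (card I * m) (f ` I)"
  using assms
proof (induction I rule: finite_induct)
  case empty
  then show ?case by (simp add: computes_given)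
next
  case (insert i I)
  have "computes X (m + card I * m) ({f i} \<union> f ` I)"
    by (rule computes_Un) (use insert in auto)
  then show ?case using insert by simp
qed

lemma computes_step:
  assumes "computes X m Y"
    and "\<And>k F. straight_line X k F \<Longrightarrow> Y \<subseteq> F \<Longrightarrow> straight_line X (Suc k) (insert f F)"
  shows "computes X (Suc m) {f}"
  using assms unfolding computes_def by (meson Suc_le_mono insert_subset singleton_iff subsetI insertI1 empty_subsetI)

lemma computes_input: "f \<in> X \<Longrightarrow> computes X 0 {f}"
  by (simp add: computes_given)

lemma computes_const: "r \<in> \<rat> \<Longrightarrow> computes X 1 {\<lambda>_. r}"
  using computes_step[OF computes_given[of "{}" X]] straight_line.intros(2) by fastforce

lemma computes_sqrt:
  assumes f: "computes X a {f}"
  shows "computes X (a + 1) {\<lambda>D. sqrt (f D)}"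
  using computes_step[OF f] straight_line.intros(7) by fastforce

context
  fixes X :: "('d \<Rightarrow> real) set" and a b :: nat and f g :: "'d \<Rightarrow> real"
  assumes f: "computes X a {f}" and g: "computes X b {g}"
begin

lemma computes_add: "computes X (a + b + 1) {\<lambda>D. f D + g D}"
  using computes_step[OF computes_Un[OF f g]] straight_line.intros(3) by fastforce

lemma computes_diff: "computes X (a + b + 1) {\<lambda>D. f D - g D}"
  using computes_step[OF computes_Un[OF f g]] straight_line.intros(4) by fastforce

lemma computes_mult: "computes X (a + b + 1) {\<lambda>D. f D * g D}"
  using computes_step[OF computes_Un[OF f g]] straight_line.intros(5) by fastforce

lemma computes_divide: "computes X (a + b + 1) {\<lambda>D. f D / g D}"
  using computes_step[OF computes_Un[OF f g]] straight_line.intros(6) by fastforce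

lemma computes_if_nonpos:
  assumes h: "computes X c {h}"
  shows "computes X (c + a + b + 1) {\<lambda>D. if h D \<le> 0 then f D else g D}"
  using computes_step[OF computes_Un[OF computes_Un[OF h f] g],
      where f = "\<lambda>D. if h D \<le> 0 then f D else g D"] straight_line.intros(8)[of X _ _ h f g]
  by simp

end

lemma computes_sum:
  assumes "finite I" "\<And>i. i \<in> I \<Longrightarrow> computes X m {f i}"
  shows "computes X (card I * (m + 1) + 1) {\<lambda>D. \<Sum>i\<in>I. f i D}"
  using assms
proof (induction I rule: finite_induct)
  case empty
  then show ?case using computes_const[of 0 X] by simp
next
  case (insert i I)
  have "computes X (m + (card I * (m + 1) + 1) + 1) {\<lambda>D. f i D + (\<Sum>i\<in>I. f i D)}"
    by (rule computes_add) (use insert in auto)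
  then show ?case using insert by (simp add: ac_simps)
qed

section \<open>Gaussian elimination\<close>

text \<open>
  Elimination works on a shrinking index set, so definiteness is relativised to a set. Positivity of the
  form is the invariant that passes to Schur complements and keeps all pivots positive.
\<close>

definition pos_def_on :: "'i set \<Rightarrow> ('i \<Rightarrow> 'i \<Rightarrow> real) \<Rightarrow> bool" where
  "pos_def_on S B \<longleftrightarrow> (\<forall>x. (\<exists>i\<in>S. x i \<noteq> 0) \<longrightarrow> 0 < (\<Sum>i\<in>S. \<Sum>j\<in>S. x i * B i j * x j))"

lemma pivot_pos:
  assumes "finite S" "k \<notin> S" "pos_def_on (insert k S) B"
  shows "0 < B k k"
proof -
  define e :: "'a \<Rightarrow> real" where "e i = (if i = k then 1 else 0)" for i
  have e: "e i = 0" if "i \<in> S" for i using that assms(2) by (auto simp: e_def)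
  have "e k = 1" by (simp add: e_def)
  then have "0 < (\<Sum>i\<in>insert k S. \<Sum>j\<in>insert k S. e i * B i j * e j)"
    using assms(3)[unfolded pos_def_on_def, rule_format, of e] by simp
  then show ?thesis using assms(1,2) e \<open>e k = 1\<close> by simp
qed

text \<open>
  Given \<open>x\<close> on \<open>S\<close>, the choice \<open>x\<^sub>k = - (\<Sum>j\<in>S. B\<^sub>k\<^sub>j x\<^sub>j) / B\<^sub>k\<^sub>k\<close> kills row \<open>k\<close>, and the value of
  the form of \<open>B\<close> at the extended vector is the value of the form of the Schur complement at \<open>x\<close>.
\<close>

lemma schur_complement_pos_def:
  assumes "finite S" "k \<notin> S" "pos_def_on (insert k S) B"
  shows "pos_def_on S (\<lambda>i j. B i j - B i k * B k j / B k k)"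
  unfolding pos_def_on_def
proof (intro allI impI)
  fix x :: "'a \<Rightarrow> real"
  assume "\<exists>i\<in>S. x i \<noteq> 0"
  define R where "R = (\<Sum>j\<in>S. B k j * x j)"
  define C where "C = (\<Sum>i\<in>S. x i * B i k)"
  define Q where "Q = (\<Sum>i\<in>S. \<Sum>j\<in>S. x i * B i j * x j)"
  define y where "y = x(k := - R / B k k)"
  have pos: "0 < B k k" by (rule pivot_pos[OF assms])
  have y: "y i = x i" if "i \<in> S" for i using that assms(2) by (auto simp: y_def)
  have "\<exists>i\<in>insert k S. y i \<noteq> 0" using \<open>\<exists>i\<in>S. x i \<noteq> 0\<close> y by auto
  then have "0 < (\<Sum>i\<in>insert k S. \<Sum>j\<in>insert k S. y i * B i j * y j)"
    using assms(3) unfolding pos_def_on_def by blast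
  also have "\<dots> = y k * B k k * y k + (\<Sum>j\<in>S. y k * B k j * x j)
      + ((\<Sum>i\<in>S. x i * B i k * y k) + Q)"
    using assms(1,2) y by (simp add: sum.distrib Q_def)
  also have "\<dots> = y k * B k k * y k + y k * R + (C * y k + Q)"
    by (simp add: R_def C_def sum_distrib_left sum_distrib_right mult.assoc)
  also have "\<dots> = Q - C * R / B k k"
    using pos by (simp add: y_def field_simps)
  also have "\<dots> = (\<Sum>i\<in>S. \<Sum>j\<in>S. x i * (B i j - B i k * B k j / B k k) * x j)"
  proof -
    have "C * R / B k k = (\<Sum>i\<in>S. \<Sum>j\<in>S. x i * B i k * (B k j * x j) / B k k)"
      by (simp add: C_def R_def sum_product sum_divide_distrib)
    then show ?thesis by (simp add: Q_def algebra_simps sum_subtractf)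
  qed
  finally show "0 < (\<Sum>i\<in>S. \<Sum>j\<in>S. x i * (B i j - B i k * B k j / B k k) * x j)" .
qed

lemma back_substitution:
  fixes B :: "'i \<Rightarrow> 'i \<Rightarrow> real"
  assumes "finite S" "k \<notin> S" "B k k \<noteq> 0"
    and xk: "x k = (b k - (\<Sum>j\<in>S. B k j * x j)) / B k k"
    and x: "\<And>i. i \<in> S \<Longrightarrow> (\<Sum>j\<in>S. (B i j - B i k * B k j / B k k) * x j) = b i - B i k * b k / B k k"
    and "i \<in> insert k S"
  shows "(\<Sum>j\<in>insert k S. B i j * x j) = b i"
proof (cases "i = k")
  case True
  then show ?thesis using assms by simp
next
  case False
  then have i: "i \<in> S" using assms by simp
  have "(\<Sum>j\<in>S. (B i j - B i k * B k j / B k k) * x j)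
      = (\<Sum>j\<in>S. B i j * x j) - B i k / B k k * (\<Sum>j\<in>S. B k j * x j)"
    by (simp add: algebra_simps sum_subtractf sum_distrib_left)
  moreover have "(\<Sum>j\<in>S. B k j * x j) = b k - B k k * x k" using xk assms(3) by simp
  ultimately have "(\<Sum>j\<in>S. B i j * x j) + B i k * x k = b i"
    using x[OF i] assms(3) by (simp add: right_diff_distrib)
  then show ?thesis using assms by simp
qed

text \<open>
  Definiteness makes every pivot positive, so elimination needs no row exchanges and the same sequence
  of operations is correct for every instance in \<open>P\<close>. Eliminating one index out of \<open>m + 1\<close> costs
  \<open>3 m\<^sup>2 + 3 m\<close> steps for the reduced system and \<open>2 m + 3\<close> for the back substitution, at most
  the difference \<open>3 (m + 1)\<^sup>3 - 3 m\<^sup>3\<close>.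
\<close>

lemma computes_linear_solution:
  fixes A :: "'i \<Rightarrow> 'i \<Rightarrow> 'd \<Rightarrow> real" and b :: "'i \<Rightarrow> 'd \<Rightarrow> real"
  assumes "finite S"
    and "\<And>i j. i \<in> S \<Longrightarrow> j \<in> S \<Longrightarrow> A i j \<in> X" and "\<And>i. i \<in> S \<Longrightarrow> b i \<in> X"
    and "\<And>D. D \<in> P \<Longrightarrow> pos_def_on S (\<lambda>i j. A i j D)"
  shows "\<exists>x. computes X (3 * card S ^ 3) (x ` S) \<and>
    (\<forall>D\<in>P. \<forall>i\<in>S. (\<Sum>j\<in>S. A i j D * x j D) = b i D)"
  using assms
proof (induction S arbitrary: A b X rule: finite_induct)
  case empty
  then show ?case by (auto intro: computes_given)
next
  case (insert k S)
  define A' where "A' = (\<lambda>i j D. A i j D - A i k D * A k j D / A k k D)"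
  define b' where "b' = (\<lambda>i D. b i D - A i k D * b k D / A k k D)"
  define m where "m = card S"
  define Y where "Y = case_prod A' ` (S \<times> S) \<union> b' ` S"
  have A: "computes X 0 {A i j}" if "i \<in> insert k S" "j \<in> insert k S" for i j
    using insert.prems(1) that by (intro computes_input)
  have b: "computes X 0 {b i}" if "i \<in> insert k S" for i
    using insert.prems(2) that by (intro computes_input)
  have A': "computes X 3 {case_prod A' p}" if p: "p \<in> S \<times> S" for p
  proof -
    obtain i j where ij: "p = (i, j)" "i \<in> S" "j \<in> S" using p by (cases p) auto
    have "computes X (0 + (0 + 0 + 1 + 0 + 1) + 1) {A' i j}"
      unfolding A'_def by (intro computes_diff computes_divide computes_mult A) (use ij in auto)
    then show ?thesis by (simp add: ij numeral_3_eq_3)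
  qed
  have b': "computes X 3 {b' i}" if "i \<in> S" for i
  proof -
    have "computes X (0 + (0 + 0 + 1 + 0 + 1) + 1) {b' i}"
      unfolding b'_def by (intro computes_diff computes_divide computes_mult A b) (use that in auto)
    then show ?thesis by (simp add: numeral_3_eq_3)
  qed
  have Y: "computes X (m * m * 3 + m * 3) Y"
    unfolding Y_def
    using computes_Un[OF computes_family[of "S \<times> S" X 3 "case_prod A'"] computes_family[of S X 3 b']]
      A' b' insert.hyps by (simp add: m_def)
  have "\<exists>x. computes (X \<union> Y) (3 * card S ^ 3) (x ` S) \<and>
      (\<forall>D\<in>P. \<forall>i\<in>S. (\<Sum>j\<in>S. A' i j D * x j D) = b' i D)"
  proof (rule insert.IH)
    fix D assume "D \<in> P"
    then show "pos_def_on S (\<lambda>i j. A' i j D)"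
      unfolding A'_def by (intro schur_complement_pos_def insert.hyps insert.prems(3))
  qed (auto simp: Y_def)
  then obtain x where x: "computes (X \<union> Y) (3 * m ^ 3) (x ` S)"
      and sol: "\<And>D i. D \<in> P \<Longrightarrow> i \<in> S \<Longrightarrow> (\<Sum>j\<in>S. A' i j D * x j D) = b' i D"
    by (auto simp: m_def)
  define xk where "xk = (\<lambda>D. (b k D - (\<Sum>j\<in>S. A k j D * x j D)) / A k k D)"
  define x' where "x' = x(k := xk)"
  have x'S: "x' j = x j" if "j \<in> S" for j using that insert.hyps by (auto simp: x'_def)
  let ?Z = "X \<union> Y \<union> x ` S"
  have Z: "computes X (m * m * 3 + m * 3 + 3 * m ^ 3) ?Z"
    using computes_then[OF Y x] .
  have "computes ?Z (0 + (card S * (0 + 0 + 1 + 1) + 1) + 1 + 0 + 1) {xk}"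
    unfolding xk_def
    by (intro computes_divide computes_diff computes_sum computes_mult computes_input)
      (use insert in auto)
  then have "computes X (m * m * 3 + m * 3 + 3 * m ^ 3 + (2 * m + 3)) (X \<union> ?Z \<union> {xk})"
    by (intro computes_then[OF Z]) (auto elim: computes_more_inputs computes_weaken simp: m_def Un_ac)
  then have "computes X (3 * card (insert k S) ^ 3) (x' ` insert k S)"
  proof (rule computes_weaken)
    show "m * m * 3 + m * 3 + 3 * m ^ 3 + (2 * m + 3) \<le> 3 * card (insert k S) ^ 3"
      using insert.hyps by (simp add: m_def power3_eq_cube algebra_simps)
    show "x' ` insert k S \<subseteq> X \<union> ?Z \<union> {xk}"
      using x'S by (auto simp: x'_def)
  qed
  moreover have "(\<Sum>j\<in>insert k S. A i j D * x' j D) = b i D" if "D \<in> P" "i \<in> insert k S" for D i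
  proof (rule back_substitution[where B = "\<lambda>i j. A i j D" and x = "\<lambda>j. x' j D" and b = "\<lambda>i. b i D"])
    show "A k k D \<noteq> 0"
      using pivot_pos[OF insert.hyps insert.prems(3)[OF that(1)]] by simp
    show "x' k D = (b k D - (\<Sum>j\<in>S. A k j D * x' j D)) / A k k D"
      using x'S by (simp add: x'_def[THEN fun_cong, of k] xk_def)
    show "(\<Sum>j\<in>S. (A i j D - A i k D * A k j D / A k k D) * x' j D) = b i D - A i k D * b k D / A k k D"
      if "i \<in> S" for i
      using sol[OF \<open>D \<in> P\<close> that] x'S by (simp add: A'_def b'_def)
  qed (use insert.hyps that in auto)
  ultimately show ?case by blast
qed

section \<open>Rotated coordinates\<close>

lemma inner_transpose_mult_vec: "(transpose A *v x) \<bullet> y = x \<bullet> (A *v (y :: real^'n))"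
  by (simp add: dot_lmul_matrix)

(* The default rewriting to row-vector products would hide the adjoints used below. *)
declare transpose_matrix_vector [simp del]

lemma blk_stack3 [simp]:
  "blk1 (stack3 a b c) = a" "blk2 (stack3 a b c) = b" "blk3 (stack3 a b c) = c"
  by (simp_all add: blk1_def blk2_def blk3_def stack3_def vec_eq_iff)

lemma stack3_nth [simp]:
  "stack3 a b c $ Inl i = a $ i" "stack3 a b c $ Inr (Inl i) = b $ i" "stack3 a b c $ Inr (Inr i) = c $ i"
  by (simp_all add: stack3_def)

lemma index3_cases: obtains i where "k = Inl i" | i where "k = Inr (Inl i)" | i where "k = Inr (Inr i)"
  by (metis sumE)

lemma vec3_eq_iff: "v = w \<longleftrightarrow> blk1 v = blk1 w \<and> blk2 v = blk2 w \<and> blk3 v = blk3 w"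
proof
  assume r: "blk1 v = blk1 w \<and> blk2 v = blk2 w \<and> blk3 v = blk3 w"
  have "v $ k = w $ k" for k
    using r by (cases k rule: index3_cases) (simp_all add: blk1_def blk2_def blk3_def vec_eq_iff)
  then show "v = w" by (simp add: vec_eq_iff)
qed simp

lemma blk_linear [simp]:
  fixes v w :: "'n::finite vec3"
  shows "blk1 (v + w) = blk1 v + blk1 w" "blk2 (v + w) = blk2 v + blk2 w" "blk3 (v + w) = blk3 v + blk3 w"
    "blk1 (c *\<^sub>R v) = c *\<^sub>R blk1 v" "blk2 (c *\<^sub>R v) = c *\<^sub>R blk2 v" "blk3 (c *\<^sub>R v) = c *\<^sub>R blk3 v"
  by (simp_all add: blk1_def blk2_def blk3_def vec_eq_iff)

lemma sum_index3:
  fixes f :: "'n::finite + 'n + 'n \<Rightarrow> real"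
  shows "(\<Sum>k\<in>UNIV. f k) = (\<Sum>i\<in>UNIV. f (Inl i)) + (\<Sum>i\<in>UNIV. f (Inr (Inl i))) + (\<Sum>i\<in>UNIV. f (Inr (Inr i)))"
  by (simp add: UNIV_Plus_UNIV[symmetric] sum.Plus del: UNIV_Plus_UNIV)

lemma inner_vec3:
  fixes v w :: "'n::finite vec3"
  shows "v \<bullet> w = blk1 v \<bullet> blk1 w + blk2 v \<bullet> blk2 w + blk3 v \<bullet> blk3 w"
  by (simp add: inner_vec_def sum_index3 blk1_def blk2_def blk3_def)

text \<open>
  Multiplication by the transpose of \<open>G_mat\<close> for the identity matrix in place of \<open>V\<close>. The eigenvectors
  of \<open>M\<close> only affect the middle block, so everything about the outer blocks can be said without them;
  this also gives coordinates in which no eigenvalue has to be computed.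
\<close>

definition rot :: "'n::finite vec3 \<Rightarrow> 'n vec3" where
  "rot w = stack3 ((1/2) *\<^sub>R (blk1 w + blk2 w) - (sqrt 2 / 2) *\<^sub>R blk3 w)
     ((sqrt 2 / 2) *\<^sub>R (blk1 w - blk2 w))
     ((1/2) *\<^sub>R (blk1 w + blk2 w) + (sqrt 2 / 2) *\<^sub>R blk3 w)"

definition unrot :: "'n::finite vec3 \<Rightarrow> 'n vec3" where
  "unrot z = stack3
     ((1/2) *\<^sub>R (blk1 z + blk3 z) + (sqrt 2 / 2) *\<^sub>R blk2 z)
     ((1/2) *\<^sub>R (blk1 z + blk3 z) - (sqrt 2 / 2) *\<^sub>R blk2 z)
     ((sqrt 2 / 2) *\<^sub>R (blk3 z - blk1 z))"

lemma sqrt2_mult_sqrt2 [simp]: "sqrt 2 * (sqrt 2 * a) = 2 * a"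
  by (simp add: mult.assoc[symmetric])

lemma rot_unrot [simp]: "rot (unrot z) = z"
  by (simp add: rot_def unrot_def vec3_eq_iff vec_eq_iff algebra_simps)

lemma unrot_rot [simp]: "unrot (rot w) = w"
  by (simp add: rot_def unrot_def vec3_eq_iff vec_eq_iff algebra_simps)

lemma inner_rot: "rot v \<bullet> rot w = v \<bullet> w"
  by (simp add: rot_def inner_vec3 inner_add_left inner_add_right inner_diff_left
      inner_diff_right algebra_simps)

text \<open>
  The outer blocks are half of \<open>x\<^sup>+ + x\<^sup>-\<close> plus or minus a multiple of \<open>\<xi>\<close>, so by polarisation
  orthogonality of \<open>x\<^sup>+ + x\<^sup>-\<close> and \<open>\<xi>\<close> is equality of their norms.
\<close>

lemma Z1_iff: "w \<in> Z1 \<longleftrightarrow> norm (blk1 (rot w)) = norm (blk3 (rot w))"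
proof -
  have "blk3 (rot w) \<bullet> blk3 (rot w) - blk1 (rot w) \<bullet> blk1 (rot w)
      = sqrt 2 * ((blk1 w + blk2 w) \<bullet> blk3 w)"
    by (simp add: rot_def inner_add_left inner_add_right inner_diff_left
      inner_diff_right inner_commute algebra_simps)
  then show ?thesis
    by (auto simp: Z1_def norm_eq)
qed

lemma stack3_mult_vec: "stack3 A B C *v z = stack3 (A *v z) (B *v z) (C *v z)"
  by (simp add: vec3_eq_iff blk1_def blk2_def blk3_def matrix_vector_mult_def vec_eq_iff)

lemma block_row_mult_vec: "block_row A B C *v z = A *v blk1 z + B *v blk2 z + C *v blk3 z"
  by (simp add: vec_eq_iff block_row_def matrix_vector_mult_def sum_index3 blk1_def blk2_def blk3_def)

lemma mat_mult_vec: "mat c *v (x :: real^'n) = c *\<^sub>R x"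
  by (simp add: vec_eq_iff matrix_vector_mult_def mat_def if_distrib[of "\<lambda>a. a * _"] cong: if_cong)

lemma G_mat_mult_vec: "G_mat V *v z = unrot (stack3 (blk1 z) (V *v blk2 z) (blk3 z))"
  by (simp add: G_mat_def matrix_vector_mul_assoc[symmetric] stack3_mult_vec block_row_mult_vec
      mat_mult_vec unrot_def algebra_simps)

text \<open>
  The adjoint of \<open>unrot\<close> is \<open>rot\<close>, since \<open>rot\<close> preserves inner products and inverts it.
\<close>

lemma transpose_G_mat_mult_vec:
  "transpose (G_mat V) *v h
     = stack3 (blk1 (rot h)) (transpose V *v blk2 (rot h)) (blk3 (rot h))" (is "_ = ?r")
proof -
  have "(transpose (G_mat V) *v h) \<bullet> z = ?r \<bullet> z" for z
  proof -
    have "(transpose (G_mat V) *v h) \<bullet> z = h \<bullet> (G_mat V *v z)"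
      by (simp add: inner_transpose_mult_vec)
    also have "\<dots> = rot h \<bullet> stack3 (blk1 z) (V *v blk2 z) (blk3 z)"
      unfolding G_mat_mult_vec by (subst inner_rot[symmetric]) (simp only: rot_unrot)
    also have "\<dots> = ?r \<bullet> z"
      by (simp add: inner_vec3 inner_transpose_mult_vec)
    finally show ?thesis .
  qed
  then show ?thesis using vector_eq_rdot by blast
qed

section \<open>The reduced problem\<close>

text \<open>
  The common form of both objectives in rotated coordinates \<open>z\<close>, with \<open>A = \<beta> I + 4 M\<close>. The update
  minimises it over equal norms \<open>|z\<^sub>1| = |z\<^sub>3|\<close> with \<open>t\<close> equal to the common square, the convex program
  with \<open>t\<close> an upper bound for both squares.
\<close>

definition reduced_objective :: "real \<Rightarrow> real^'n^'n \<Rightarrow> 'n::finite vec3 \<Rightarrow> 'n vec3 \<Rightarrow> real \<Rightarrow> real" where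
  "reduced_objective \<beta> A q z t = 1/2 * (blk2 z \<bullet> (A *v blk2 z)) + q \<bullet> z + \<beta> * t"

text \<open>
  The closed form before diagonalisation: the middle block is given by a linear system instead of by
  eigenvalues.
\<close>

definition reduced_solution :: "real \<Rightarrow> real^'n^'n \<Rightarrow> 'n::finite vec3 \<Rightarrow> 'n vec3 \<Rightarrow> bool" where
  "reduced_solution \<beta> A q z \<longleftrightarrow>
     outer_block \<beta> (blk1 q) (blk3 q) (blk1 z) \<and>
     outer_block \<beta> (blk3 q) (blk1 q) (blk3 z) \<and>
     A *v blk2 z = - blk2 q"

text \<open>
  The case distinction of the closed form is the equality case of Cauchy-Schwarz: the block has a
  prescribed norm and points against \<open>q\<close>, and for \<open>q = 0\<close> the second condition is void.
\<close>

lemma outer_block_iff: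
  fixes q x :: "real^'n"
  assumes "\<beta> > 0"
  shows "outer_block \<beta> q q' x \<longleftrightarrow>
    norm x = (norm q + norm q') / (2 * \<beta>) \<and> q \<bullet> x = - (norm q * norm x)"
proof (cases "q = 0")
  case True
  obtain e :: "real^'n" where e: "norm e = 1" using vector_choose_size[of 1] by auto
  have pos: "0 \<le> norm q' / (2 * \<beta>)" using assms by simp
  have polar: "\<exists>u. norm u = 1 \<and> x = norm x *\<^sub>R u"
  proof (cases "x = 0")
    case False
    then show ?thesis by (intro exI[of _ "sgn x"]) (simp add: norm_sgn sgn_div_norm)
  qed (use e in auto)
  have "(\<exists>u. norm u = 1 \<and> x = (norm q' / (2 * \<beta>)) *\<^sub>R u) \<longleftrightarrow> norm x = norm q' / (2 * \<beta>)"
  proof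
    assume "norm x = norm q' / (2 * \<beta>)"
    with polar show "\<exists>u. norm u = 1 \<and> x = (norm q' / (2 * \<beta>)) *\<^sub>R u" by metis
  qed (use pos assms in \<open>auto simp: abs_of_nonneg\<close>)
  then show ?thesis using True by (simp add: outer_block_def)
next
  case False
  then have q: "norm q > 0" by simp
  show ?thesis
  proof
    assume "outer_block \<beta> q q' x"
    then have x: "x = (- (norm q + norm q') / (2 * \<beta> * norm q)) *\<^sub>R q"
      using q by (simp add: outer_block_def)
    have "\<bar>- (norm q + norm q')\<bar> = norm q + norm q'" by (simp only: abs_minus_cancel) simp
    then have n: "norm x = (norm q + norm q') / (2 * \<beta>)"
      unfolding x using q assms by (simp add: abs_mult abs_divide del: minus_add_distrib)
    have "q \<bullet> x = - (norm q + norm q') / (2 * \<beta> * norm q) * (norm q)\<^sup>2"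
      unfolding x by (simp add: power2_norm_eq_inner)
    also have "\<dots> = - (norm q * ((norm q + norm q') / (2 * \<beta>)))"
      using q assms by (simp add: power2_eq_square field_simps)
    finally show "norm x = (norm q + norm q') / (2 * \<beta>) \<and> q \<bullet> x = - (norm q * norm x)"
      using n by simp
  next
    assume r: "norm x = (norm q + norm q') / (2 * \<beta>) \<and> q \<bullet> x = - (norm q * norm x)"
    then have "q \<bullet> (- x) = norm q * norm (- x)" by simp
    then have "norm q *\<^sub>R (- x) = norm x *\<^sub>R q"
      unfolding norm_cauchy_schwarz_eq by (simp only: norm_minus_cancel)
    then have eq: "- (norm q *\<^sub>R x) = norm x *\<^sub>R q" by (simp only: scaleR_minus_right)
    have scal: "- (norm x / norm q) = - (norm q + norm q') / (2 * \<beta> * norm q)"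
      unfolding conjunct1[OF r] minus_divide_left by simp
    have "x = (1 / norm q) *\<^sub>R (norm q *\<^sub>R x)" using q by simp
    also have "norm q *\<^sub>R x = - (norm x *\<^sub>R q)" by (simp only: eq[symmetric] minus_minus)
    also have "(1 / norm q) *\<^sub>R (- (norm x *\<^sub>R q)) = (- (norm x / norm q)) *\<^sub>R q" by simp
    also have "\<dots> = (- (norm q + norm q') / (2 * \<beta> * norm q)) *\<^sub>R q"
      unfolding scal ..
    finally show "outer_block \<beta> q q' x" using q by (simp add: outer_block_def)
  qed
qed

lemma symmetric_form_complete_square:
  fixes A :: "real^'n^'n"
  assumes "transpose A = A" "A *v p0 = - b"
  shows "1/2 * (p \<bullet> (A *v p)) + b \<bullet> p
     = 1/2 * ((p - p0) \<bullet> (A *v (p - p0))) + (1/2 * (p0 \<bullet> (A *v p0)) + b \<bullet> p0)"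
proof -
  have sym: "x \<bullet> (A *v y) = y \<bullet> (A *v x)" for x y
    by (metis assms(1) inner_transpose_mult_vec inner_commute)
  have b: "b = - (A *v p0)" using assms(2) by simp
  show ?thesis unfolding b
    by (simp add: matrix_vector_mult_diff_distrib inner_diff_left inner_diff_right sym[of p0 p]
        inner_commute[of "A *v _"] algebra_simps)
qed

lemma ball_term_ge:
  assumes "(norm x)\<^sup>2 \<le> (t::real)"
  shows "- (norm q * sqrt t) \<le> q \<bullet> x"
proof -
  have "\<bar>q \<bullet> x\<bar> \<le> norm q * norm x" by (rule Cauchy_Schwarz_ineq2)
  also have "\<dots> \<le> norm q * sqrt t" using assms by (intro mult_left_mono real_le_rsqrt) auto
  finally show ?thesis by simp
qed

text \<open>
  The excess over the value at a reduced solution as a sum of four terms, each nonnegative on the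
  relaxed feasible set: a square in the middle block, a Cauchy-Schwarz gap for each outer block, and
  the square that completes \<open>\<beta> t - (|q\<^sub>1| + |q\<^sub>3|) sqrt t\<close>. Minimality and uniqueness both come from it.
\<close>

lemma reduced_objective_decomposition:
  assumes "\<beta> > 0" "transpose A = A" "reduced_solution \<beta> A q z0" "0 \<le> t"
  defines "r \<equiv> (norm (blk1 q) + norm (blk3 q)) / (2 * \<beta>)"
  shows "reduced_objective \<beta> A q z t - reduced_objective \<beta> A q z0 ((norm (blk1 z0))\<^sup>2)
    = 1/2 * ((blk2 z - blk2 z0) \<bullet> (A *v (blk2 z - blk2 z0)))
      + (norm (blk1 q) * sqrt t + blk1 q \<bullet> blk1 z)
      + (norm (blk3 q) * sqrt t + blk3 q \<bullet> blk3 z)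
      + \<beta> * (sqrt t - r)\<^sup>2"
proof -
  have o: "norm (blk1 z0) = r" "blk1 q \<bullet> blk1 z0 = - (norm (blk1 q) * r)"
      "blk3 q \<bullet> blk3 z0 = - (norm (blk3 q) * r)" "A *v blk2 z0 = - blk2 q"
    using assms(3) unfolding reduced_solution_def outer_block_iff[OF assms(1)]
    by (auto simp: r_def add.commute)
  have sum: "norm (blk1 q) = 2 * \<beta> * r - norm (blk3 q)" using assms(1) by (simp add: r_def)
  have t: "t = (sqrt t)\<^sup>2" using assms(4) by simp
  show ?thesis
    unfolding reduced_objective_def inner_vec3[of q] o(1) o(2) o(3)
    using symmetric_form_complete_square[OF assms(2) o(4), of "blk2 z"]
    by (subst (1) t) (simp add: sum power2_eq_square algebra_simps)
qed

lemma pos_defD: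
  fixes A :: "real^'n^'n"
  assumes "pos_def A"
  shows "transpose A = A" "0 \<le> x \<bullet> (A *v x)" "x \<bullet> (A *v x) = 0 \<Longrightarrow> x = 0"
proof -
  have pos: "0 < x \<bullet> (A *v x)" if "x \<noteq> 0" using assms that by (simp add: pos_def_def)
  show "transpose A = A" using assms by (simp add: pos_def_def)
  show "0 \<le> x \<bullet> (A *v x)" using pos by (cases "x = 0") auto
  show "x = 0" if "x \<bullet> (A *v x) = 0" using pos that by auto
qed

lemma reduced_solution_minimal:
  assumes "\<beta> > 0" "pos_def A" "reduced_solution \<beta> A q z0"
    and "(norm (blk1 z))\<^sup>2 \<le> t" "(norm (blk3 z))\<^sup>2 \<le> t"
  shows "reduced_objective \<beta> A q z0 ((norm (blk1 z0))\<^sup>2) \<le> reduced_objective \<beta> A q z t"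
proof -
  have t: "0 \<le> t" using assms(4) by (meson order_trans zero_le_power2)
  show ?thesis
    using reduced_objective_decomposition[OF assms(1) pos_defD(1)[OF assms(2)] assms(3) t, of z]
      ball_term_ge[OF assms(4), of "blk1 q"] ball_term_ge[OF assms(5), of "blk3 q"]
      pos_defD(2)[OF assms(2), of "blk2 z - blk2 z0"]
      mult_nonneg_nonneg[OF less_imp_le[OF assms(1)] zero_le_power2,
        of "sqrt t - (norm (blk1 q) + norm (blk3 q)) / (2 * \<beta>)"]
    by linarith
qed

text \<open>
  On the set of equal norms the four nonnegative terms of the excess vanish simultaneously only if all
  the conditions of \<open>reduced_solution\<close> hold. With the norms merely bounded by \<open>sqrt t\<close> this would
  fail: for \<open>q\<^sub>1 = 0\<close> and \<open>q\<^sub>3 \<noteq> 0\<close> the norm of \<open>z\<^sub>1\<close> is then undetermined.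
\<close>

lemma reduced_solution_if_value_le:
  assumes "\<beta> > 0" "pos_def A" "reduced_solution \<beta> A q z0"
    and "norm (blk1 z) = norm (blk3 z)"
    and "reduced_objective \<beta> A q z ((norm (blk1 z))\<^sup>2)
      \<le> reduced_objective \<beta> A q z0 ((norm (blk1 z0))\<^sup>2)"
  shows "reduced_solution \<beta> A q z"
proof -
  define r where "r = (norm (blk1 q) + norm (blk3 q)) / (2 * \<beta>)"
  define P where "P = blk2 z - blk2 z0"
  have sq: "sqrt ((norm (blk1 z))\<^sup>2) = norm (blk1 z)" by simp
  have "1/2 * (P \<bullet> (A *v P))
      + (norm (blk1 q) * norm (blk1 z) + blk1 q \<bullet> blk1 z)
      + (norm (blk3 q) * norm (blk1 z) + blk3 q \<bullet> blk3 z)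
      + \<beta> * (norm (blk1 z) - r)\<^sup>2 \<le> 0"
    using reduced_objective_decomposition[OF assms(1) pos_defD(1)[OF assms(2)] assms(3), of "(norm (blk1 z))\<^sup>2" z]
      assms(5) unfolding sq r_def[symmetric] P_def[symmetric] by simp
  moreover have "0 \<le> P \<bullet> (A *v P)" by (rule pos_defD(2)[OF assms(2)])
  moreover have "0 \<le> norm (blk1 q) * norm (blk1 z) + blk1 q \<bullet> blk1 z"
    using ball_term_ge[of "blk1 z" "(norm (blk1 z))\<^sup>2" "blk1 q"] by simp
  moreover have "0 \<le> norm (blk3 q) * norm (blk1 z) + blk3 q \<bullet> blk3 z"
    using ball_term_ge[of "blk3 z" "(norm (blk1 z))\<^sup>2" "blk3 q"] assms(4) by simp
  moreover have "0 \<le> \<beta> * (norm (blk1 z) - r)\<^sup>2" using assms(1) by simp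
  ultimately have eq: "P \<bullet> (A *v P) = 0" "blk1 q \<bullet> blk1 z = - (norm (blk1 q) * norm (blk1 z))"
      "blk3 q \<bullet> blk3 z = - (norm (blk3 q) * norm (blk1 z))" "\<beta> * (norm (blk1 z) - r)\<^sup>2 = 0"
    by linarith+
  from eq(1) have "P = 0" by (rule pos_defD(3)[OF assms(2)])
  then have "A *v blk2 z = - blk2 q" using assms(3) by (simp add: P_def reduced_solution_def)
  moreover have "norm (blk1 z) = r" using eq(4) assms(1) by simp
  ultimately show ?thesis
    using eq assms(4) unfolding reduced_solution_def outer_block_iff[OF assms(1)]
    by (simp add: r_def add.commute)
qed

lemma reduced_solution_norms:
  assumes "\<beta> > 0" "reduced_solution \<beta> A q z"
  shows "norm (blk1 z) = norm (blk3 z)"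
  using assms(2) unfolding reduced_solution_def outer_block_iff[OF assms(1)] by (simp add: add.commute)

lemma pos_def_surj:
  fixes A :: "real^'n^'n"
  assumes "pos_def A"
  obtains p where "A *v p = b"
proof -
  have "inj ((*v) A)"
  proof (rule injI)
    fix x y assume "A *v x = A *v y"
    then have "A *v (x - y) = 0" by (simp add: matrix_vector_mult_diff_distrib)
    then show "x = y" using pos_defD(3)[OF assms, of "x - y"] by simp
  qed
  then have "surj ((*v) A)" by (rule linear_inj_imp_surj[OF matrix_vector_mul_linear])
  then show thesis using that by (metis surjD)
qed

lemma reduced_solution_exists:
  fixes A :: "real^'n^'n"
  assumes "\<beta> > 0" "pos_def A"
  obtains z where "reduced_solution \<beta> A q z"
proof -
  obtain p where p: "A *v p = - blk2 q" using pos_def_surj[OF assms(2)] .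
  obtain e :: "real^'n" where e: "norm e = 1" using vector_choose_size[of 1] by auto
  have ex: "\<exists>x. outer_block \<beta> q q' (x::real^'n)" for q q'
    using e by (auto simp: outer_block_def)
  obtain x where x: "outer_block \<beta> (blk1 q) (blk3 q) x" using ex by blast
  obtain y where y: "outer_block \<beta> (blk3 q) (blk1 q) y" using ex by blast
  show thesis by (rule that[of "stack3 x p y"]) (simp add: reduced_solution_def x y p)
qed

section \<open>The update and the convex program in rotated coordinates\<close>

definition shifted :: "real \<Rightarrow> real^'n^'n \<Rightarrow> real^'n^'n" where
  "shifted \<beta> M = \<beta> *\<^sub>R mat 1 + 4 *\<^sub>R M"

lemma shifted_mult_vec: "shifted \<beta> M *v x = \<beta> *\<^sub>R x + 4 *\<^sub>R (M *v x)"
  by (simp add: shifted_def matrix_vector_mult_add_rdistrib scaleR_matrix_vector_assoc[symmetric])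

lemma cp_objective_rot:
  "cp_objective M h \<beta> (w, t) = reduced_objective \<beta> (shifted \<beta> M) (rot h) (rot w) t"
proof -
  have "blk2 (rot w) = (sqrt 2 / 2) *\<^sub>R (blk1 w - blk2 w)" by (simp add: rot_def)
  then show ?thesis
    by (simp add: cp_objective_def reduced_objective_def inner_rot shifted_mult_vec
        matrix_vector_mult_scaleR power2_norm_eq_inner inner_add_right del: scaleR_diff_right)
      (simp add: field_simps)
qed

lemma cp_feasible_rot:
  "(w, t) \<in> cp_feasible \<longleftrightarrow> (norm (blk1 (rot w)))\<^sup>2 \<le> t \<and> (norm (blk3 (rot w)))\<^sup>2 \<le> t"
  by (simp add: cp_feasible_def rot_def)

lemma cp_solution_if_reduced_solution:
  assumes "\<beta> > 0" "pos_def (shifted \<beta> M)" "reduced_solution \<beta> (shifted \<beta> M) (rot h) (rot w)"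
  shows "cp_solution M h \<beta> (w, (norm (blk1 (rot w)))\<^sup>2)"
  using reduced_solution_minimal[OF assms] reduced_solution_norms[OF assms(1,3)]
  by (auto simp: cp_solution_def is_arg_min_def cp_feasible_rot cp_objective_rot not_less)

text \<open>
  Lowering \<open>t\<close> to the common squared norm keeps a point of \<open>Z1\<close> feasible and does not increase the
  objective, so the value of a solution of the relaxation is attained on \<open>Z1\<close>, where it characterises
  the reduced solutions.
\<close>

lemma cp_solution_iff:
  assumes "\<beta> > 0" "pos_def (shifted \<beta> M)"
  shows "w \<in> Z1 \<and> (\<exists>t. cp_solution M h \<beta> (w, t)) \<longleftrightarrow>
    reduced_solution \<beta> (shifted \<beta> M) (rot h) (rot w)"
proof
  assume r: "w \<in> Z1 \<and> (\<exists>t. cp_solution M h \<beta> (w, t))"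
  then obtain t where t: "cp_solution M h \<beta> (w, t)" by blast
  obtain z0 where z0: "reduced_solution \<beta> (shifted \<beta> M) (rot h) z0"
    using reduced_solution_exists[OF assms] .
  let ?E = "reduced_objective \<beta> (shifted \<beta> M) (rot h)"
  have "((unrot z0), (norm (blk1 z0))\<^sup>2) \<in> cp_feasible"
    using reduced_solution_norms[OF assms(1) z0] by (simp add: cp_feasible_rot)
  then have le: "?E (rot w) t \<le> ?E z0 ((norm (blk1 z0))\<^sup>2)"
    using t cp_objective_rot[of M h \<beta> "unrot z0"]
    by (force simp: cp_solution_def is_arg_min_def cp_objective_rot not_less)
  have "(norm (blk1 (rot w)))\<^sup>2 \<le> t"
    using t by (simp add: cp_solution_def is_arg_min_def cp_feasible_rot)
  then have "?E (rot w) ((norm (blk1 (rot w)))\<^sup>2) \<le> ?E (rot w) t"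
    using assms(1) by (simp add: reduced_objective_def)
  with le have "?E (rot w) ((norm (blk1 (rot w)))\<^sup>2) \<le> ?E z0 ((norm (blk1 z0))\<^sup>2)" by simp
  then show "reduced_solution \<beta> (shifted \<beta> M) (rot h) (rot w)"
    using r by (intro reduced_solution_if_value_le[OF assms z0]) (auto simp: Z1_iff)
next
  assume r: "reduced_solution \<beta> (shifted \<beta> M) (rot h) (rot w)"
  then show "w \<in> Z1 \<and> (\<exists>t. cp_solution M h \<beta> (w, t))"
    using cp_solution_if_reduced_solution[OF assms r] reduced_solution_norms[OF assms(1) r]
    unfolding Z1_iff by blast
qed

lemma h_vec_inner:
  fixes w :: "'n::finite vec3"
  shows "h_vec d \<gamma> \<rho> \<alpha> \<mu> wk yk lamk \<bullet> w = d \<bullet> (blk1 w - blk2 w) - \<gamma> * (\<Sum>i\<in>UNIV. blk3 w $ i)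
    + (1 - \<rho> * \<alpha>) * (lamk \<bullet> w) - \<rho> * (yk \<bullet> w) - \<mu> * (wk \<bullet> w)"
proof -
  have "(1 :: real^'n) \<bullet> blk3 w = (\<Sum>i\<in>UNIV. blk3 w $ i)" by (simp add: inner_vec_def)
  then have "stack3 d (- d) (- (\<gamma> *\<^sub>R 1)) \<bullet> w = d \<bullet> (blk1 w - blk2 w) - \<gamma> * (\<Sum>i\<in>UNIV. blk3 w $ i)"
    by (simp add: inner_vec3 inner_diff_right)
  then show ?thesis by (simp add: h_vec_def inner_diff_left inner_add_left)
qed

lemma inner_self_Z1:
  assumes "w \<in> Z1"
  shows "w \<bullet> w = 2 * (norm (blk1 (rot w)))\<^sup>2 + 1/2 * (norm (blk1 w - blk2 w))\<^sup>2"
proof -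
  have b2: "blk2 (rot w) \<bullet> blk2 (rot w) = 1/2 * (norm (blk1 w - blk2 w))\<^sup>2"
    by (simp add: rot_def power2_norm_eq_inner)
  have "blk1 (rot w) \<bullet> blk1 (rot w) = (norm (blk1 (rot w)))\<^sup>2"
    "blk3 (rot w) \<bullet> blk3 (rot w) = (norm (blk1 (rot w)))\<^sup>2"
    using assms by (simp_all add: Z1_iff power2_norm_eq_inner[symmetric])
  then show ?thesis using b2 inner_vec3[of "rot w" "rot w"] inner_rot[of w w] by linarith
qed

text \<open>
  On \<open>Z1\<close> the quadratic terms of the proximal augmented Lagrangian contribute \<open>\<beta>/2 |w|\<^sup>2\<close>, which is
  \<open>\<beta> |z\<^sub>1|\<^sup>2 + \<beta>/4 |x|\<^sup>2\<close> with \<open>x = x\<^sup>+ - x\<^sup>-\<close> and \<open>z = rot w\<close>; the linear terms are collected by \<open>h\<close>.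
\<close>

lemma update_objective_eq:
  fixes M :: "real^'n^'n"
  assumes "w \<in> Z1"
  shows "L_tilde M d \<gamma> g \<rho> \<alpha> w yk lamk + \<mu> / 2 * (norm (w - wk))\<^sup>2
    = cp_objective M (h_vec d \<gamma> \<rho> \<alpha> \<mu> wk yk lamk) (\<rho> + \<mu>) (w, (norm (blk1 (rot w)))\<^sup>2)
      + (\<gamma> * CARD('n) + g (blk1 yk - blk2 yk) - (1 - \<rho> * \<alpha>) * (lamk \<bullet> (yk + \<alpha> *\<^sub>R lamk))
         + \<rho> / 2 * (yk \<bullet> yk) + \<mu> / 2 * (wk \<bullet> wk))"
proof -
  have sq: "(norm (w - v))\<^sup>2 = 2 * (norm (blk1 (rot w)))\<^sup>2 + 1/2 * (norm (blk1 w - blk2 w))\<^sup>2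
      - 2 * (v \<bullet> w) + v \<bullet> v" for v
    unfolding power2_norm_eq_inner[of "w - v"] inner_self_Z1[OF assms, symmetric]
    by (simp add: inner_diff_left inner_diff_right inner_commute[of w v])
  have lam: "lamk \<bullet> (w - yk - \<alpha> *\<^sub>R lamk) = lamk \<bullet> w - lamk \<bullet> (yk + \<alpha> *\<^sub>R lamk)"
    by (simp add: inner_diff_right inner_add_right)
  have lin: "(\<Sum>i\<in>UNIV. 1 - blk3 w $ i) = CARD('n) - (\<Sum>i\<in>UNIV. blk3 w $ i)"
    by (simp add: sum_subtractf)
  show ?thesis
    unfolding L_tilde_def f_Q_def cp_objective_def prod.case h_vec_inner sq lam lin
    by (simp add: field_simps)
qed

lemma update1_solution_iff:
  assumes "\<rho> + \<mu> > 0" "pos_def (shifted (\<rho> + \<mu>) M)"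
  shows "update1_solution M d \<gamma> g \<rho> \<alpha> \<mu> wk yk lamk w \<longleftrightarrow>
    reduced_solution (\<rho> + \<mu>) (shifted (\<rho> + \<mu>) M) (rot (h_vec d \<gamma> \<rho> \<alpha> \<mu> wk yk lamk)) (rot w)"
proof -
  let ?\<beta> = "\<rho> + \<mu>" and ?q = "rot (h_vec d \<gamma> \<rho> \<alpha> \<mu> wk yk lamk)"
  let ?E = "\<lambda>z. reduced_objective ?\<beta> (shifted ?\<beta> M) ?q z ((norm (blk1 z))\<^sup>2)"
  define f where "f = (\<lambda>w. L_tilde M d \<gamma> g \<rho> \<alpha> w yk lamk + \<mu> / 2 * (norm (w - wk))\<^sup>2)"
  obtain C where C: "\<And>w. w \<in> Z1 \<Longrightarrow> f w = ?E (rot w) + C"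
    using that update_objective_eq[of _ M d \<gamma> g \<rho> \<alpha> yk lamk \<mu> wk]
    unfolding f_def cp_objective_rot by blast
  have upd: "update1_solution M d \<gamma> g \<rho> \<alpha> \<mu> wk yk lamk w \<longleftrightarrow>
      w \<in> Z1 \<and> (\<forall>v\<in>Z1. ?E (rot w) \<le> ?E (rot v))"
    unfolding update1_solution_def is_arg_min_def f_def[symmetric] by (auto simp: C not_less)
  show ?thesis
  proof
    assume r: "update1_solution M d \<gamma> g \<rho> \<alpha> \<mu> wk yk lamk w"
    obtain z0 where z0: "reduced_solution ?\<beta> (shifted ?\<beta> M) ?q z0"
      using reduced_solution_exists[OF assms] .
    have "unrot z0 \<in> Z1" using reduced_solution_norms[OF assms(1) z0] by (simp add: Z1_iff)
    then have "?E (rot w) \<le> ?E (rot (unrot z0))" using r unfolding upd by blast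
    then have "?E (rot w) \<le> ?E z0" by simp
    then show "reduced_solution ?\<beta> (shifted ?\<beta> M) ?q (rot w)"
      using r unfolding upd Z1_iff by (intro reduced_solution_if_value_le[OF assms z0]) blast+
  next
    assume r: "reduced_solution ?\<beta> (shifted ?\<beta> M) ?q (rot w)"
    show "update1_solution M d \<gamma> g \<rho> \<alpha> \<mu> wk yk lamk w"
      unfolding upd
    proof (intro conjI ballI)
      show "w \<in> Z1" using reduced_solution_norms[OF assms(1) r] by (simp only: Z1_iff)
      show "?E (rot w) \<le> ?E (rot v)" if "v \<in> Z1" for v
        using that unfolding Z1_iff by (intro reduced_solution_minimal[OF assms r]) simp_all
    qed
  qed
qed

section \<open>Convexity\<close>

lemma convex_cp_feasible: "convex (cp_feasible :: ('n::finite vec3 \<times> real) set)"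
proof -
  have sq: "(norm (u *\<^sub>R x + v *\<^sub>R y))\<^sup>2 \<le> u * s + v * t"
    if "0 \<le> u" "0 \<le> v" "u + v = 1" "(norm x)\<^sup>2 \<le> s" "(norm y)\<^sup>2 \<le> t" for u v s t and x y :: "real^'n"
  proof -
    have v: "v = 1 - u" using that by simp
    have "0 \<le> u * v * ((x - y) \<bullet> (x - y))" using that by simp
    then have "(norm (u *\<^sub>R x + v *\<^sub>R y))\<^sup>2 \<le> u * (norm x)\<^sup>2 + v * (norm y)\<^sup>2"
      unfolding power2_norm_eq_inner v
      by (simp add: inner_add_left inner_add_right inner_diff_left inner_diff_right inner_commute algebra_simps)
    also have "\<dots> \<le> u * s + v * t" using that by (intro add_mono mult_left_mono) auto
    finally show ?thesis .
  qed
  have lin: "blk1 (rot (u *\<^sub>R x + v *\<^sub>R y)) = u *\<^sub>R blk1 (rot x) + v *\<^sub>R blk1 (rot y)"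
    "blk3 (rot (u *\<^sub>R x + v *\<^sub>R y)) = u *\<^sub>R blk3 (rot x) + v *\<^sub>R blk3 (rot y)"
    for u v and x y :: "'n vec3"
    unfolding rot_def blk_linear blk_stack3 by (simp_all add: algebra_simps)
  show ?thesis
    unfolding convex_def by (auto simp: cp_feasible_rot lin intro!: sq)
qed

text \<open>
  The quadratic part is one quarter of the form of \<open>\<beta> I + 4 M\<close> at \<open>x\<^sup>+ - x\<^sup>-\<close>, and the convexity
  defect of a quadratic form along a segment is \<open>u (1 - u)\<close> times its value at the difference.
\<close>

lemma convex_on_cp_objective:
  fixes M :: "real^'n^'n"
  assumes "pos_def (shifted \<beta> M)"
  shows "convex_on cp_feasible (cp_objective M h \<beta>)"
proof (rule convex_onI)
  fix u :: real and p q :: "'n vec3 \<times> real"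
  assume u: "0 < u" "u < 1"
  obtain w s where p: "p = (w, s)" by (cases p)
  obtain v t where q: "q = (v, t)" by (cases q)
  define x y where "x = blk1 w - blk2 w" and "y = blk1 v - blk2 v"
  have lin: "blk1 ((1 - u) *\<^sub>R w + u *\<^sub>R v) - blk2 ((1 - u) *\<^sub>R w + u *\<^sub>R v) = (1 - u) *\<^sub>R x + u *\<^sub>R y"
    unfolding x_def y_def blk_linear by (simp add: algebra_simps)
  have "0 \<le> 1/4 * ((1 - u) * u * ((x - y) \<bullet> (shifted \<beta> M *v (x - y))))"
    using u pos_defD(2)[OF assms] by simp
  then show "cp_objective M h \<beta> ((1 - u) *\<^sub>R p + u *\<^sub>R q)
      \<le> (1 - u) * cp_objective M h \<beta> p + u * cp_objective M h \<beta> q"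
    unfolding cp_objective_def p q shifted_mult_vec scaleR_Pair add_Pair prod.case lin
    by (simp add: x_def[symmetric] y_def[symmetric] power2_norm_eq_inner inner_add_left
        inner_add_right inner_diff_left inner_diff_right inner_commute[of y x]
        matrix_vector_right_distrib matrix_vector_mult_diff_distrib matrix_vector_mult_scaleR
        field_simps)
qed (rule convex_cp_feasible)

section \<open>Spectral data\<close>

lemma eigenvalue_list_eigenvector:
  fixes M :: "real^'n^'n"
  assumes "eigenvalue_list M s"
  obtains v where "v \<noteq> 0" "M *v v = (s $ i) *\<^sub>R v"
proof -
  have "det (mat (s $ i) - M) = 0"
    using assms unfolding eigenvalue_list_def by (metis UNIV_I diff_self finite prod_zero)
  then obtain v where "v \<noteq> 0" "(mat (s $ i) - M) *v v = 0"
    using invertible_det_nz[of "mat (s $ i) - M"] invertible_left_inverse[of "mat (s $ i) - M"]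
      matrix_left_invertible_ker[of "mat (s $ i) - M"] by blast
  then show thesis
    using that by (simp add: matrix_vector_mult_diff_rdistrib mat_mult_vec)
qed

lemma shifted_eigenvalue_pos:
  assumes "pos_def (shifted \<beta> M)" "eigenvalue_list M s"
  shows "\<beta> + 4 * s $ i > 0"
proof -
  obtain v where v: "v \<noteq> 0" "M *v v = (s $ i) *\<^sub>R v" using eigenvalue_list_eigenvector[OF assms(2)] .
  have "0 < v \<bullet> (shifted \<beta> M *v v)" using assms(1) v(1) by (simp add: pos_def_def)
  also have "\<dots> = (\<beta> + 4 * s $ i) * (v \<bullet> v)"
    by (simp add: shifted_mult_vec v(2) inner_add_right algebra_simps)
  finally show ?thesis using v(1) zero_less_mult_pos2[of "\<beta> + 4 * s $ i" "v \<bullet> v"] by simp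
qed

lemma diag_mat_mult_vec: "(diag_mat s *v x) $ i = s $ i * x $ i"
  by (simp add: diag_mat_def matrix_vector_mult_def if_distrib[of "\<lambda>a. a * _"] cong: if_cong)

text \<open>
  An orthogonal \<open>V\<close> diagonalising \<open>M\<close> also diagonalises \<open>\<beta> I + 4 M\<close>; this decouples the linear system
  for the middle block into the \<open>CARD('n)\<close> scalar equations of the formula.
\<close>

lemma z_formula_iff_reduced_solution:
  fixes V M :: "real^'n^'n"
  assumes V: "orthogonal_matrix V" "transpose V ** M ** V = diag_mat s"
    and pos: "\<And>i. \<beta> + 4 * s $ i > 0"
  shows "z_formula \<beta> s (transpose (G_mat V) *v h) z \<longleftrightarrow>
    reduced_solution \<beta> (shifted \<beta> M) (rot h) (stack3 (blk1 z) (V *v blk2 z) (blk3 z))"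
proof -
  let ?y = "blk2 z" and ?b = "blk2 (rot h)"
  have VV: "transpose V ** V = mat 1" "V ** transpose V = mat 1"
    using V(1) by (auto simp: orthogonal_matrix_def)
  have inj: "transpose V *v x = transpose V *v y \<longleftrightarrow> x = y" for x y :: "real^'n"
  proof
    assume "transpose V *v x = transpose V *v y"
    then have "V *v (transpose V *v x) = V *v (transpose V *v y)" by simp
    then show "x = y" by (simp add: matrix_vector_mul_assoc VV)
  qed simp
  have "transpose V *v (V *v ?y) = ?y" "transpose V *v (M *v (V *v ?y)) = diag_mat s *v ?y"
    by (simp_all add: matrix_vector_mul_assoc VV V(2)[symmetric] matrix_mul_assoc)
  then have "transpose V *v (shifted \<beta> M *v (V *v ?y)) = \<beta> *\<^sub>R ?y + 4 *\<^sub>R (diag_mat s *v ?y)"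
    by (simp add: shifted_mult_vec matrix_vector_right_distrib matrix_vector_mult_scaleR)
  then have "shifted \<beta> M *v (V *v ?y) = - ?b \<longleftrightarrow>
      \<beta> *\<^sub>R ?y + 4 *\<^sub>R (diag_mat s *v ?y) = - (transpose V *v ?b)"
    using inj[of "shifted \<beta> M *v (V *v ?y)" "- ?b"] linear_neg[OF matrix_vector_mul_linear[of "transpose V"], of ?b]
    by simp
  also have "\<dots> \<longleftrightarrow> (\<forall>i. (\<beta> + 4 * s $ i) * ?y $ i = - ((transpose V *v ?b) $ i))"
    by (simp add: vec_eq_iff diag_mat_mult_vec algebra_simps)
  also have "\<dots> \<longleftrightarrow> (\<forall>i. ?y $ i = - ((transpose V *v ?b) $ i) / (\<beta> + 4 * s $ i))"
    using nonzero_eq_divide_eq[OF less_imp_neq[OF pos, THEN not_sym]] by (simp only: mult.commute[of "?y $ _"])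
  finally show ?thesis
    by (simp add: z_formula_def reduced_solution_def transpose_G_mat_mult_vec)
qed

lemma closed_form_iff:
  fixes V M :: "real^'n^'n"
  assumes V: "orthogonal_matrix V" "transpose V ** M ** V = diag_mat s"
    and pos: "\<And>i. \<beta> + 4 * s $ i > 0"
  shows "(\<exists>z. z_formula \<beta> s (transpose (G_mat V) *v h) z \<and> w = G_mat V *v z) \<longleftrightarrow>
    reduced_solution \<beta> (shifted \<beta> M) (rot h) (rot w)"
proof
  assume "reduced_solution \<beta> (shifted \<beta> M) (rot h) (rot w)"
  moreover define z where "z = stack3 (blk1 (rot w)) (transpose V *v blk2 (rot w)) (blk3 (rot w))"
  moreover have "stack3 (blk1 z) (V *v blk2 z) (blk3 z) = rot w"
    using V(1) by (simp add: z_def matrix_vector_mul_assoc orthogonal_matrix_def vec3_eq_iff)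
  ultimately have "z_formula \<beta> s (transpose (G_mat V) *v h) z \<and> w = G_mat V *v z"
    unfolding z_formula_iff_reduced_solution[OF assms] G_mat_mult_vec by simp
  then show "\<exists>z. z_formula \<beta> s (transpose (G_mat V) *v h) z \<and> w = G_mat V *v z" ..
qed (auto simp: z_formula_iff_reduced_solution[OF assms] G_mat_mult_vec)

section \<open>Tractability\<close>

lemmas computes_intros = computes_if_nonpos computes_add computes_diff computes_mult
  computes_divide computes_sqrt computes_const computes_input

lemma pos_def_imp_pos_def_on:
  assumes "pos_def A"
  shows "pos_def_on UNIV (\<lambda>i j. A $ i $ j)"
  unfolding pos_def_on_def
proof (intro allI impI)
  fix x :: "'a \<Rightarrow> real"
  assume "\<exists>i\<in>UNIV. x i \<noteq> 0"
  then have "(\<chi> i. x i) \<noteq> 0" by (auto simp: vec_eq_iff)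
  then have "0 < (\<chi> i. x i) \<bullet> (A *v (\<chi> i. x i))" using assms by (simp add: pos_def_def)
  also have "\<dots> = (\<Sum>i\<in>UNIV. \<Sum>j\<in>UNIV. x i * A $ i $ j * x j)"
    by (simp add: inner_vec_def matrix_vector_mult_def sum_distrib_left mult.assoc)
  finally show "0 < (\<Sum>i\<in>UNIV. \<Sum>j\<in>UNIV. x i * A $ i $ j * x j)" .
qed

text \<open>
  A determinate choice among the outer blocks, with the coordinate vector \<open>axis k 1\<close> as the unit vector
  for \<open>q = 0\<close>. The test is written as \<open>norm q \<le> 0\<close>, the form of branching that a straight-line
  computation has.
\<close>

definition some_outer_block :: "'n \<Rightarrow> real \<Rightarrow> real^'n \<Rightarrow> real^'n" where
  "some_outer_block k r q =
     (\<chi> i. if norm q \<le> 0 then r * of_bool (i = k) else 0 - r * q $ i / norm q)"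

lemma outer_block_some:
  assumes "r = (norm q + norm q') / (2 * \<beta>)"
  shows "outer_block \<beta> q q' (some_outer_block k r q)"
proof (cases "q = 0")
  case True
  then have "some_outer_block k r q = (norm q' / (2 * \<beta>)) *\<^sub>R axis k 1"
    by (simp add: some_outer_block_def assms vec_eq_iff axis_def)
  then show ?thesis using True by (auto simp: outer_block_def intro!: exI[of _ "axis k 1"])
next
  case False
  then have "some_outer_block k r q = - (((norm q + norm q') / (2 * \<beta> * norm q)) *\<^sub>R q)"
    by (intro vec_eq_iff[THEN iffD2] allI) (simp add: some_outer_block_def assms)
  also have "\<dots> = (- (norm q + norm q') / (2 * \<beta> * norm q)) *\<^sub>R q"
    by (simp only: minus_divide_left[symmetric] scaleR_minus_left)
  finally have "some_outer_block k r q = (- (norm q + norm q') / (2 * \<beta> * norm q)) *\<^sub>R q" .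
  then show ?thesis using False by (simp add: outer_block_def)
qed

text \<open>
  The three kinds of blocks differ only in their first summand, which costs at most two steps.
\<close>

lemma computes_dat_h:
  "computes inputs 12 {\<lambda>D :: ('n::finite) update_data. dat_h D $ k}"
proof -
  define tail where "tail s = (\<lambda>D :: 'n update_data. s D + (1 - dat_rho D * dat_alpha D) * dat_lam D $ k
      - dat_rho D * dat_y D $ k - dat_mu D * dat_w D $ k)" for s
  have tail: "computes inputs (m + 9) {tail s}" if "computes inputs m {s}" for m s
  proof -
    have "computes inputs (m + (1 + (0 + 0 + 1) + 1 + 0 + 1) + 1 + (0 + 0 + 1) + 1 + (0 + 0 + 1) + 1) {tail s}"
      unfolding tail_def by (intro computes_intros that) (auto simp: inputs_def)
    then show ?thesis by (rule computes_weaken) auto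
  qed
  show ?thesis
  proof (cases k rule: index3_cases)
    case (1 i)
    have "computes inputs (0 + 9) {tail (\<lambda>D. dat_d D $ i)}"
      by (intro tail computes_input) (auto simp: inputs_def)
    then show ?thesis
      by (rule computes_weaken) (auto simp: 1 tail_def dat_h_def h_vec_def fun_eq_iff)
  next
    case (2 i)
    have "computes inputs ((1 + 0 + 1) + 9) {tail (\<lambda>D. 0 - dat_d D $ i)}"
      by (intro tail computes_intros) (auto simp: inputs_def)
    then show ?thesis
      by (rule computes_weaken) (auto simp: 2 tail_def dat_h_def h_vec_def fun_eq_iff)
  next
    case (3 i)
    have "computes inputs ((1 + 0 + 1) + 9) {tail (\<lambda>D. 0 - dat_gamma D)}"
      by (intro tail computes_intros) (auto simp: inputs_def)
    then show ?thesis
      by (rule computes_weaken) (auto simp: 3 tail_def dat_h_def h_vec_def fun_eq_iff)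
  qed
qed

text \<open>
  The three terms occurring in \<open>rot\<close> and in \<open>unrot\<close>.
\<close>

lemma computes_rotation:
  assumes "computes X 0 {a}" "computes X 0 {b}" "computes X 0 {c}"
  shows "computes X 9 {\<lambda>D. 1/2 * (a D + b D) + sqrt 2 / 2 * c D}"
    and "computes X 9 {\<lambda>D. 1/2 * (a D + b D) - sqrt 2 / 2 * c D}"
    and "computes X 9 {\<lambda>D. sqrt 2 / 2 * (a D - b D)}"
proof -
  have half: "computes X 1 {\<lambda>D. 1/2}"
    by (intro computes_const) auto
  have "computes X ((1 + 1) + 1 + 1) {\<lambda>D. sqrt 2 / 2}"
    by (intro computes_divide computes_sqrt computes_const) auto
  then have half_sqrt: "computes X 4 {\<lambda>D. sqrt 2 / 2}"
    by (rule computes_weaken) auto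
  have "computes X ((1 + (0 + 0 + 1) + 1) + (4 + 0 + 1) + 1) {\<lambda>D. 1/2 * (a D + b D) + sqrt 2 / 2 * c D}"
    by (intro computes_add computes_mult half half_sqrt assms)
  then show "computes X 9 {\<lambda>D. 1/2 * (a D + b D) + sqrt 2 / 2 * c D}"
    by (rule computes_weaken) auto
  have "computes X ((1 + (0 + 0 + 1) + 1) + (4 + 0 + 1) + 1) {\<lambda>D. 1/2 * (a D + b D) - sqrt 2 / 2 * c D}"
    by (intro computes_add computes_diff computes_mult half half_sqrt assms)
  then show "computes X 9 {\<lambda>D. 1/2 * (a D + b D) - sqrt 2 / 2 * c D}"
    by (rule computes_weaken) auto
  have "computes X (4 + (0 + 0 + 1) + 1) {\<lambda>D. sqrt 2 / 2 * (a D - b D)}"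
    by (intro computes_diff computes_mult half_sqrt assms)
  then show "computes X 9 {\<lambda>D. sqrt 2 / 2 * (a D - b D)}"
    by (rule computes_weaken) auto
qed

text \<open>
  In general the eigenvalues of \<open>M\<close> are not expressible by arithmetic operations and square roots. The
  rotated coordinates avoid them: the middle block solves a positive definite linear system, and the
  outer blocks need two norms. The linear system dominates the cost, which is cubic.
\<close>

lemma cp_tractable: "cp_tractable TYPE('n::finite)"
proof -
  let ?n = "CARD('n)"
  \<comment> \<open>The direction of an outer block whose counterpart in \<open>q\<close> vanishes is free; any index serves.\<close>
  define k0 :: 'n where "k0 = undefined"
  define \<beta> where "\<beta> = (\<lambda>D :: 'n update_data. dat_rho D + dat_mu D)"
  define h where "h k = (\<lambda>D :: 'n update_data. dat_h D $ k)" for k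
  define q where "q k = (\<lambda>D :: 'n update_data. rot (dat_h D) $ k)" for k
  define A where "A i j = (\<lambda>D :: 'n update_data. shifted (\<beta> D) (dat_M D) $ i $ j)" for i j
  define b where "b i = (\<lambda>D :: 'n update_data. - q (Inr (Inl i)) D)" for i
  define N1 where "N1 = (\<lambda>D :: 'n update_data. norm (blk1 (rot (dat_h D))))"
  define N3 where "N3 = (\<lambda>D :: 'n update_data. norm (blk3 (rot (dat_h D))))"
  define r where "r = (\<lambda>D. (N1 D + N3 D) / (2 * \<beta> D))"
  define z1 where "z1 i = (\<lambda>D. some_outer_block k0 (r D) (blk1 (rot (dat_h D))) $ i)" for i
  define z3 where "z3 i = (\<lambda>D. some_outer_block k0 (r D) (blk3 (rot (dat_h D))) $ i)" for i

  \<comment> \<open>The vector \<open>h\<close>.\<close>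
  define X1 where "X1 = inputs \<union> h ` UNIV"
  have X1: "computes inputs (36 * ?n) X1"
  proof -
    have "computes inputs (card (UNIV :: ('n + 'n + 'n) set) * 12) (h ` UNIV)"
      by (intro computes_family) (auto simp: h_def computes_dat_h)
    then have "computes inputs (36 * ?n) (h ` UNIV)"
      by (rule computes_weaken) auto
    from computes_Un[OF computes_given[OF subset_refl] this] show ?thesis
      by (simp add: X1_def)
  qed

  \<comment> \<open>Its rotation and the linear system for the middle block.\<close>
  define X2 where "X2 = X1 \<union> (q ` UNIV \<union> (case_prod A ` UNIV \<union> b ` UNIV))"
  have X2: "computes inputs (36 * ?n + (27 * ?n + (6 * ?n\<^sup>2 + 11 * ?n))) X2"
  proof -
    have h: "computes X1 0 {h k}" for k by (intro computes_input) (simp add: X1_def)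
    have M: "computes X1 0 {\<lambda>D. dat_M D $ i $ j}" for i j
      by (intro computes_input) (auto simp: X1_def inputs_def)
    have \<beta>: "computes X1 (0 + 0 + 1) {\<beta>}"
      unfolding \<beta>_def by (intro computes_add computes_input) (auto simp: X1_def inputs_def)
    have q: "computes X1 9 {q k}" for k
    proof (cases k rule: index3_cases)
      case (1 i)
      show ?thesis
        using computes_rotation(2)[OF h[of "Inl i"] h[of "Inr (Inl i)"] h[of "Inr (Inr i)"]]
        by (simp add: 1 q_def h_def rot_def blk1_def blk2_def blk3_def)
    next
      case (2 i)
      show ?thesis
        using computes_rotation(3)[OF h[of "Inl i"] h[of "Inr (Inl i)"] h[of "Inr (Inr i)"]]
        by (simp add: 2 q_def h_def rot_def blk1_def blk2_def blk3_def)
    next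
      case (3 i)
      show ?thesis
        using computes_rotation(1)[OF h[of "Inl i"] h[of "Inr (Inl i)"] h[of "Inr (Inr i)"]]
        by (simp add: 3 q_def h_def rot_def blk1_def blk2_def blk3_def)
    qed
    have b: "computes X1 11 {b i}" for i
    proof -
      \<comment> \<open>Negation is not an elementary step; it costs a constant and a subtraction.\<close>
      have "computes X1 (1 + 9 + 1) {\<lambda>D. 0 - q (Inr (Inl i)) D}"
        by (intro computes_diff computes_const q) auto
      then show ?thesis by (simp add: b_def)
    qed
    have A: "computes X1 6 {case_prod A p}" for p
    proof -
      obtain i j where p: "p = (i, j)" by (cases p)
      have "computes X1 ((1 + 1 + 1) + (1 + 0 + 1) + 1) {\<lambda>D. \<beta> D * of_bool (i = j) + 4 * dat_M D $ i $ j}"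
        using \<beta> by (intro computes_add computes_mult computes_const M) auto
      moreover have A_ij: "A i j = (\<lambda>D. \<beta> D * of_bool (i = j) + 4 * dat_M D $ i $ j)"
        by (simp add: A_def shifted_def mat_def fun_eq_iff)
      ultimately show ?thesis unfolding p prod.case A_ij by (elim computes_weaken) simp_all
    qed
    have "computes X1 (card (UNIV :: ('n + 'n + 'n) set) * 9 +
        (card (UNIV :: ('n \<times> 'n) set) * 6 + card (UNIV :: 'n set) * 11))
        (q ` UNIV \<union> (case_prod A ` UNIV \<union> b ` UNIV))"
      by (intro computes_Un computes_family q A b) auto
    then have "computes X1 (27 * ?n + (6 * ?n\<^sup>2 + 11 * ?n)) (q ` UNIV \<union> (case_prod A ` UNIV \<union> b ` UNIV))"
      by (rule computes_weaken) (auto simp: power2_eq_square)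
    from computes_extend[OF X1 this] show ?thesis by (simp only: X2_def)
  qed

  have "\<exists>p. computes X2 (3 * ?n ^ 3) (p ` UNIV) \<and>
      (\<forall>D\<in>instances. \<forall>i\<in>UNIV. (\<Sum>j\<in>UNIV. A i j D * p j D) = b i D)"
  proof (rule computes_linear_solution)
    fix D :: "'n update_data" assume "D \<in> instances"
    then show "pos_def_on UNIV (\<lambda>i j. A i j D)"
      unfolding A_def by (intro pos_def_imp_pos_def_on)
        (simp add: instances_def admissible_def shifted_def \<beta>_def)
  qed (auto simp: X2_def)
  then obtain p where p: "computes X2 (3 * ?n ^ 3) (p ` UNIV)"
    and p_sol: "\<And>D i. D \<in> instances \<Longrightarrow> (\<Sum>j\<in>UNIV. A i j D * p j D) = b i D" by blast

  \<comment> \<open>The norms of the outer blocks of the rotated vector.\<close>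
  define X3 where "X3 = X2 \<union> (p ` UNIV \<union> ({N1} \<union> {N3}))"
  have X3: "computes X2 (3 * ?n ^ 3 + ((2 * ?n + 2) + (2 * ?n + 2))) (p ` UNIV \<union> ({N1} \<union> {N3}))"
  proof -
    have q: "computes X2 0 {q k}" for k by (intro computes_input) (simp add: X2_def)
    have N: "computes X2 (card (UNIV :: 'n set) * (0 + 0 + 1 + 1) + 1 + 1)
        {\<lambda>D. sqrt (\<Sum>i\<in>UNIV. q (f i) D * q (f i) D)}" for f :: "'n \<Rightarrow> 'n + 'n + 'n"
      by (intro computes_sqrt computes_sum computes_mult q) auto
    have "N1 = (\<lambda>D. sqrt (\<Sum>i\<in>UNIV. q (Inl i) D * q (Inl i) D))"
      "N3 = (\<lambda>D. sqrt (\<Sum>i\<in>UNIV. q (Inr (Inr i)) D * q (Inr (Inr i)) D))"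
      by (simp_all add: N1_def N3_def q_def norm_eq_sqrt_inner inner_vec_def blk1_def blk3_def)
    with N[of Inl] N[of "\<lambda>i. Inr (Inr i)"] show ?thesis
      by (intro computes_Un p) (simp_all add: mult_2)
  qed

  \<comment> \<open>The radius \<open>r\<close> and the outer blocks of the solution.\<close>
  define X4 where "X4 = X3 \<union> ({r} \<union> (z1 ` UNIV \<union> z3 ` UNIV))"
  have X4: "computes X3 (6 + (?n * 20 + ?n * 20)) ({r} \<union> (z1 ` UNIV \<union> z3 ` UNIV))"
  proof -
    have q: "computes X3 0 {q k}" for k by (intro computes_input) (simp add: X3_def X2_def)
    have N: "computes X3 0 {N1}" "computes X3 0 {N3}"
      by (intro computes_input, simp add: X3_def)+
    have r: "computes X3 6 {r}"
    proof -
      have "computes X3 ((0 + 0 + 1) + (1 + (0 + 0 + 1) + 1) + 1) {r}"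
        unfolding r_def \<beta>_def
        by (intro computes_divide computes_add computes_mult computes_const N computes_input)
          (auto simp: X3_def X2_def X1_def inputs_def)
      then show ?thesis by (rule computes_weaken) auto
    qed
    have block: "computes X3 (0 + (6 + 1 + 1) + (1 + (6 + 0 + 1 + 0 + 1) + 1) + 1)
        {\<lambda>D. if N D \<le> 0 then r D * of_bool (i = k0) else 0 - r D * q (f i) D / N D}"
      if "computes X3 0 {N}" for N and f :: "'n \<Rightarrow> 'n + 'n + 'n" and i
      by (intro computes_if_nonpos computes_diff computes_mult computes_divide computes_const that q r) auto
    have "z1 i = (\<lambda>D. if N1 D \<le> 0 then r D * of_bool (i = k0) else 0 - r D * q (Inl i) D / N1 D)"
      "z3 i = (\<lambda>D. if N3 D \<le> 0 then r D * of_bool (i = k0) else 0 - r D * q (Inr (Inr i)) D / N3 D)"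
      for i
      by (simp_all add: z1_def z3_def some_outer_block_def N1_def N3_def q_def blk1_def blk3_def fun_eq_iff)
    then have "computes X3 20 {z1 i}" "computes X3 20 {z3 i}" for i
      using block[OF N(1), of i Inl] block[OF N(2), of i "\<lambda>i. Inr (Inr i)"]
      by (simp_all only:) (elim computes_weaken; simp)+
    then show ?thesis
      by (intro computes_Un computes_family r) auto
  qed

  \<comment> \<open>The solution in the original coordinates, with \<open>t = r\<^sup>2\<close>.\<close>
  define z where "z D = stack3 (\<chi> i. z1 i D) (\<chi> i. p i D) (\<chi> i. z3 i D)" for D
  define sol where "sol D = (unrot (z D), r D * r D)" for D
  define out where "out k = (\<lambda>D. unrot (z D) $ k)" for k
  have out: "computes X4 (?n * 27 + 1) (out ` UNIV \<union> {\<lambda>D. r D * r D})"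
  proof -
    have z1: "computes X4 0 {z1 i}" and z3: "computes X4 0 {z3 i}" and p: "computes X4 0 {p i}" for i
      by (intro computes_input, simp add: X4_def X3_def)+
    have r: "computes X4 0 {r}"
      by (intro computes_input) (simp add: X4_def)
    have "computes X4 9 {out k}" for k
    proof (cases k rule: index3_cases)
      case (1 i)
      show ?thesis
        using computes_rotation(1)[OF z1[of i] z3[of i] p[of i]]
        by (simp add: 1 out_def unrot_def z_def)
    next
      case (2 i)
      show ?thesis
        using computes_rotation(2)[OF z1[of i] z3[of i] p[of i]]
        by (simp add: 2 out_def unrot_def z_def)
    next
      case (3 i)
      show ?thesis
        using computes_rotation(3)[OF z3[of i] z1[of i] p[of i]]
        by (simp add: 3 out_def unrot_def z_def)
    qed
    then have "computes X4 (card (UNIV :: ('n + 'n + 'n) set) * 9 + (0 + 0 + 1)) (out ` UNIV \<union> {\<lambda>D. r D * r D})"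
      by (intro computes_Un computes_family computes_mult r) auto
    then show ?thesis by (rule computes_weaken) auto
  qed

  have "computes inputs (1000 * ?n ^ 3) (out ` UNIV \<union> {\<lambda>D. r D * r D})"
  proof (rule computes_weaken)
    show "computes inputs (36 * ?n + (27 * ?n + (6 * ?n\<^sup>2 + 11 * ?n))
        + (3 * ?n ^ 3 + ((2 * ?n + 2) + (2 * ?n + 2))) + (6 + (?n * 20 + ?n * 20)) + (?n * 27 + 1))
        (X4 \<union> (out ` UNIV \<union> {\<lambda>D. r D * r D}))"
      using computes_extend[OF computes_extend[OF computes_extend[OF X2 X3, folded X3_def] X4, folded X4_def] out] .
    have n: "1 \<le> ?n" by (simp add: Suc_leI)
    have "?n \<le> ?n ^ 3" "?n\<^sup>2 \<le> ?n ^ 3" "1 \<le> ?n ^ 3"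
      using power_increasing[of 1 3 ?n] power_increasing[of 2 3 ?n] power_increasing[of 0 3 ?n] n
      by simp_all
    then show "36 * ?n + (27 * ?n + (6 * ?n\<^sup>2 + 11 * ?n))
        + (3 * ?n ^ 3 + ((2 * ?n + 2) + (2 * ?n + 2))) + (6 + (?n * 20 + ?n * 20)) + (?n * 27 + 1)
        \<le> 1000 * ?n ^ 3"
      by linarith
  qed (rule Un_upper2)
  then obtain m F where F: "straight_line inputs m F" "m \<le> 1000 * ?n ^ 3"
      and sub: "out ` UNIV \<union> {\<lambda>D. r D * r D} \<subseteq> F"
    unfolding computes_def by blast
  have out_F: "out k \<in> F" and r_F: "(\<lambda>D. r D * r D) \<in> F" for k using sub by auto
  have "(\<lambda>D. sol D \<bullet> c) \<in> F" if c: "c \<in> Basis" for c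
  proof -
    consider k where "c = (axis k 1, 0)" | "c = (0, 1)"
      using c by (auto simp: Basis_prod_def Basis_vec_def)
    then show ?thesis
    proof cases
      case (1 k)
      then have "(\<lambda>D. sol D \<bullet> c) = out k" by (simp add: sol_def out_def inner_axis fun_eq_iff)
      then show ?thesis using out_F by simp
    next
      case 2
      then show ?thesis using r_F by (simp add: sol_def)
    qed
  qed
  moreover have "sol D \<in> {(w, t). w \<in> Z1 \<and> cp_solution (dat_M D) (dat_h D) (dat_rho D + dat_mu D) (w, t)}"
    if D: "D \<in> instances" for D
  proof -
    have \<beta>: "\<beta> D > 0" and pd: "pos_def (shifted (\<beta> D) (dat_M D))"
      using D by (auto simp: instances_def admissible_def \<beta>_def shifted_def)
    have "shifted (\<beta> D) (dat_M D) *v (\<chi> i. p i D) = - blk2 (rot (dat_h D))"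
      using p_sol[OF D] by (simp add: vec_eq_iff matrix_vector_mult_def A_def b_def q_def blk2_def)
    moreover have "outer_block (\<beta> D) (blk1 (rot (dat_h D))) (blk3 (rot (dat_h D))) (\<chi> i. z1 i D)"
      "outer_block (\<beta> D) (blk3 (rot (dat_h D))) (blk1 (rot (dat_h D))) (\<chi> i. z3 i D)"
      unfolding z1_def z3_def vec_lambda_eta
      by (intro outer_block_some; simp add: r_def N1_def N3_def add.commute)+
    ultimately have red: "reduced_solution (\<beta> D) (shifted (\<beta> D) (dat_M D)) (rot (dat_h D)) (rot (unrot (z D)))"
      by (simp add: reduced_solution_def z_def)
    then have "norm (blk1 (z D)) = r D"
      unfolding reduced_solution_def outer_block_iff[OF \<beta>] rot_unrot r_def N1_def N3_def by blast
    then have "sol D = (unrot (z D), (norm (blk1 (rot (unrot (z D)))))\<^sup>2)"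
      by (simp only: sol_def power2_eq_square rot_unrot)
    moreover have "unrot (z D) \<in> Z1"
      using reduced_solution_norms[OF \<beta> red] by (simp add: Z1_iff)
    ultimately show ?thesis
      using cp_solution_if_reduced_solution[OF \<beta> pd red] by (simp add: \<beta>_def)
  qed
  ultimately show ?thesis
    unfolding cp_tractable_def solvable_in_steps_def using F
    by (intro exI[of _ sol] exI[of _ m] exI[of _ F] conjI ballI) assumption+
qed

section \<open>The update in closed form and as a convex program\<close>

theorem proposition1:
  fixes M :: "real^'n^'n" and s d :: "real^'n" and g :: "real^'n \<Rightarrow> real"
    and \<gamma> \<rho> \<alpha> \<mu> :: real and wk yk lamk :: "real^('n + 'n + 'n)"
  assumes "transpose M = M" and "eigenvalue_list M s"
    and "convex_on UNIV g" and "cont_differentiable g"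
    and "\<gamma> > 0" and "\<alpha> > 0" and "\<rho> > 0" and "\<mu> > 0" and "\<rho> * \<alpha> \<in> {0<..<1}"
    and "pos_def ((\<rho> + \<mu>) *\<^sub>R mat 1 + 4 *\<^sub>R M)"
  defines "h \<equiv> h_vec d \<gamma> \<rho> \<alpha> \<mu> wk yk lamk"
  shows "(\<forall>i. \<rho> + \<mu> + 4 * s $ i > 0) \<and>
    (convex_program cp_feasible (cp_objective M h (\<rho> + \<mu>)) \<and>
     cp_tractable TYPE('n) \<and>
     (\<forall>w. update1_solution M d \<gamma> g \<rho> \<alpha> \<mu> wk yk lamk w \<longleftrightarrow>
        w \<in> Z1 \<and> (\<exists>t. cp_solution M h (\<rho> + \<mu>) (w, t)))) \<and>
    (\<forall>V. orthogonal_matrix V \<and> transpose V ** M ** V = diag_mat s \<longrightarrow>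
       (\<forall>w. update1_solution M d \<gamma> g \<rho> \<alpha> \<mu> wk yk lamk w \<longleftrightarrow>
          (\<exists>z. z_formula (\<rho> + \<mu>) s (transpose (G_mat V) *v h) z \<and> w = G_mat V *v z)))"
proof -
  have \<beta>: "\<rho> + \<mu> > 0" using assms by simp
  have pd: "pos_def (shifted (\<rho> + \<mu>) M)" using assms by (simp only: shifted_def)
  have eig: "\<rho> + \<mu> + 4 * s $ i > 0" for i by (rule shifted_eigenvalue_pos[OF pd assms(2)])
  note update = update1_solution_iff[OF \<beta> pd]
  show ?thesis
  proof (intro conjI allI impI)
    show "convex_program cp_feasible (cp_objective M h (\<rho> + \<mu>))"
      unfolding convex_program_def by (intro conjI convex_cp_feasible convex_on_cp_objective pd)
    show "update1_solution M d \<gamma> g \<rho> \<alpha> \<mu> wk yk lamk w \<longleftrightarrow>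
        w \<in> Z1 \<and> (\<exists>t. cp_solution M h (\<rho> + \<mu>) (w, t))" for w
      by (simp only: update h_def cp_solution_iff[OF \<beta> pd])
    show "update1_solution M d \<gamma> g \<rho> \<alpha> \<mu> wk yk lamk w \<longleftrightarrow>
        (\<exists>z. z_formula (\<rho> + \<mu>) s (transpose (G_mat V) *v h) z \<and> w = G_mat V *v z)"
      if "orthogonal_matrix V \<and> transpose V ** M ** V = diag_mat s" for V w
      unfolding update h_def by (rule closed_form_iff[OF conjunct1[OF that] conjunct2[OF that] eig, symmetric])
  qed (rule eig cp_tractable)+
qed

end
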